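(* Let $e_1,e_2,e_3\in\mathbb{Z}[t]$ and let $E=E(t): y^2=(x-e_1)(x-e_2)(x-e_3)$ be a nonconstant elliptic curve over $\mathbb{Q}(t)$. Let $t_0\in\mathbb{Q}$ satisfy the following condition (A): for every nonconstant square-free divisor $h$ in $\mathbb{Z}[t]$ of $(e_1-e_2)(e_1-e_3)$, or of $(e_2-e_1)(e_2-e_3)$, or of $(e_3-e_1)(e_3-e_2)$, the rational number $h(t_0)$ is not a square in $\mathbb{Q}$. Then the specialization homomorphism $\sigma_{t_0}: E(\mathbb{Q}(t))\to E(t_0)(\mathbb{Q})$ is injective.
   Context: An elliptic curve over $\mathbb{Q}(t)$ is called nonconstant if it is not isomorphic over $\mathbb{Q}(t)$ to an elliptic curve defined over $\mathbb{Q}$. For $t_0\in\mathbb{Q}$, $E(t_0)$ denotes the curve over $\mathbb{Q}$ obtained by substituting $t=t_0$ in the coefficients; when it is nonsingular, the specialization homomorphism $\sigma_{t_0}:E(\mathbb{Q}(t))\to E(t_0)(\mathbb{Q})$ sends a point to the point obtained by substituting $t=t_0$ (and sends points reducing to infinity, in particular the neutral element, to the neutral element $O$). *)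

theory Defs
  imports
    "HOL-Computational_Algebra.Computational_Algebra"
    "HOL-Algebra.Group"
begin

section \<open>Elliptic curves in Weierstrass form\<close>

text \<open>
  \<open>Weierstrass a1 a2 a3 a4 a6\<close> stands for the equation
  \<open>y^2 + a1 x y + a3 y = x^3 + a2 x^2 + a4 x + a6\<close>. The formulas for the discriminant, the
  admissible changes of variables and the group law are the usual ones
  (Silverman, The Arithmetic of Elliptic Curves, Chapter III).
\<close>

datatype 'a weierstrass = Weierstrass (a1: 'a) (a2: 'a) (a3: 'a) (a4: 'a) (a6: 'a)

definition discriminant :: "'a::comm_ring_1 weierstrass \<Rightarrow> 'a" where
  "discriminant W =
    (let b2 = a1 W ^ 2 + 4 * a2 W;
         b4 = 2 * a4 W + a1 W * a3 W;
         b6 = a3 W ^ 2 + 4 * a6 W;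
         b8 = a1 W ^ 2 * a6 W + 4 * a2 W * a6 W - a1 W * a3 W * a4 W + a2 W * a3 W ^ 2 - a4 W ^ 2
     in - (b2 ^ 2 * b8) - 8 * b4 ^ 3 - 27 * b6 ^ 2 + 9 * b2 * b4 * b6)"

definition elliptic_curve :: "'a::field weierstrass \<Rightarrow> bool" where
  "elliptic_curve W \<longleftrightarrow> discriminant W \<noteq> 0"

text \<open>
  Isomorphisms over \<open>'a\<close> of elliptic curves in Weierstrass form are the substitutions
  \<open>x = u^2 x' + r\<close>, \<open>y = u^3 y' + u^2 s x' + t\<close> with \<open>u \<noteq> 0\<close>; the equations below express
  that this substitution takes the equation of \<open>W\<close> to the equation of \<open>W'\<close>.
\<close>

definition isomorphic_curves :: "'a::field weierstrass \<Rightarrow> 'a weierstrass \<Rightarrow> bool" where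
  "isomorphic_curves W W' \<longleftrightarrow>
    (\<exists>u r s t. u \<noteq> 0 \<and>
      u * a1 W' = a1 W + 2 * s \<and>
      u ^ 2 * a2 W' = a2 W - s * a1 W + 3 * r - s ^ 2 \<and>
      u ^ 3 * a3 W' = a3 W + r * a1 W + 2 * t \<and>
      u ^ 4 * a4 W' = a4 W - s * a3 W + 2 * r * a2 W - (t + r * s) * a1 W + 3 * r ^ 2 - 2 * s * t \<and>
      u ^ 6 * a6 W' =
        a6 W + r * a4 W + r ^ 2 * a2 W + r ^ 3 - t * a3 W - t ^ 2 - r * t * a1 W)"

datatype 'a point = Infinity | Affine 'a 'a

definition points :: "'a::field weierstrass \<Rightarrow> 'a point set" where
  "points W = insert Infinity
     {Affine x y | x y.
        y ^ 2 + a1 W * x * y + a3 W * y = x ^ 3 + a2 W * x ^ 2 + a4 W * x + a6 W}"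

fun add_points :: "'a::field weierstrass \<Rightarrow> 'a point \<Rightarrow> 'a point \<Rightarrow> 'a point" where
  "add_points W Infinity Q = Q"
| "add_points W P Infinity = P"
| "add_points W (Affine x1 y1) (Affine x2 y2) =
    (if x1 = x2 \<and> y1 + y2 + a1 W * x2 + a3 W = 0 then Infinity
     else
       let l = (if x1 = x2
                then (3 * x1 ^ 2 + 2 * a2 W * x1 + a4 W - a1 W * y1) / (2 * y1 + a1 W * x1 + a3 W)
                else (y2 - y1) / (x2 - x1));
           m = y1 - l * x1;
           x3 = l ^ 2 + a1 W * l - a2 W - x1 - x2
       in Affine x3 (- (l + a1 W) * x3 - m - a3 W))"

definition point_group :: "'a::field weierstrass \<Rightarrow> 'a point monoid" where
  "point_group W = \<lparr>carrier = points W, mult = add_points W, one = Infinity\<rparr>"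

text \<open>The curve \<open>y^2 = (x - e1) (x - e2) (x - e3)\<close>, see \<open>points_curve_of_roots\<close> below.\<close>

definition curve_of_roots :: "'a::field \<Rightarrow> 'a \<Rightarrow> 'a \<Rightarrow> 'a weierstrass" where
  "curve_of_roots e1 e2 e3 =
     Weierstrass 0 (- (e1 + e2 + e3)) 0 (e1 * e2 + e1 * e3 + e2 * e3) (- (e1 * e2 * e3))"

lemma points_curve_of_roots:
  "points (curve_of_roots e1 e2 e3) =
     insert Infinity {Affine x y | x y. y ^ 2 = (x - e1) * (x - e2) * (x - e3)}"
proof -
  have "x ^ 3 + - (e1 + e2 + e3) * x ^ 2 + (e1 * e2 + e1 * e3 + e2 * e3) * x + - (e1 * e2 * e3)
      = (x - e1) * (x - e2) * (x - e3)" for x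
    by (simp add: power2_eq_square power3_eq_cube algebra_simps)
  then show ?thesis
    unfolding points_def curve_of_roots_def weierstrass.sel by simp
qed

lemma discriminant_curve_of_roots:
  "discriminant (curve_of_roots e1 e2 e3) = 16 * ((e1 - e2) * (e1 - e3) * (e2 - e3)) ^ 2"
  unfolding discriminant_def curve_of_roots_def Let_def weierstrass.sel
  by (simp add: power2_eq_square power3_eq_cube algebra_simps)


section \<open>The rational function field and specialization\<close>

type_synonym ratfun = "rat poly fract"

definition const_fun :: "rat \<Rightarrow> ratfun" where
  "const_fun c = to_fract [:c:]"

definition int_poly_fun :: "int poly \<Rightarrow> ratfun" where
  "int_poly_fun p = to_fract (map_poly of_int p)"

definition nonconstant_curve :: "ratfun weierstrass \<Rightarrow> bool" where
  "nonconstant_curve W \<longleftrightarrow>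
     \<not> (\<exists>W0 :: rat weierstrass.
           elliptic_curve W0 \<and> isomorphic_curves W (map_weierstrass const_fun W0))"

definition regular_at :: "rat \<Rightarrow> ratfun \<Rightarrow> bool" where
  "regular_at t0 f \<longleftrightarrow> (\<exists>p q. f = Fract p q \<and> poly q t0 \<noteq> 0)"

text \<open>Only meaningful if \<open>f\<close> is regular at \<open>t0\<close>.\<close>

definition eval_fun :: "rat \<Rightarrow> ratfun \<Rightarrow> rat" where
  "eval_fun t0 f = (THE v. \<exists>p q. f = Fract p q \<and> poly q t0 \<noteq> 0 \<and> v = poly p t0 / poly q t0)"

lemma eval_fun_Fract:
  assumes "poly q t0 \<noteq> 0"
  shows "eval_fun t0 (Fract p q) = poly p t0 / poly q t0"
  unfolding eval_fun_def
proof (rule the_equality)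
  fix v
  assume "\<exists>p' q'. Fract p q = Fract p' q' \<and> poly q' t0 \<noteq> 0 \<and> v = poly p' t0 / poly q' t0"
  then obtain p' q' where *: "Fract p q = Fract p' q'" "poly q' t0 \<noteq> 0"
    "v = poly p' t0 / poly q' t0" by blast
  have "q \<noteq> 0" "q' \<noteq> 0" using assms *(2) by auto
  then have "p * q' = p' * q" using *(1) by (simp add: eq_fract)
  then have "poly p t0 * poly q' t0 = poly p' t0 * poly q t0" by (metis poly_mult)
  then show "v = poly p t0 / poly q t0" using assms *(2,3) by (simp add: frac_eq_eq)
qed (use assms in blast)

definition specialize_curve :: "rat \<Rightarrow> ratfun weierstrass \<Rightarrow> rat weierstrass" where
  "specialize_curve t0 W = map_weierstrass (eval_fun t0) W"

lemma specialize_curve_of_roots: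
  "specialize_curve t0 (curve_of_roots (int_poly_fun e1) (int_poly_fun e2) (int_poly_fun e3)) =
     curve_of_roots (poly (map_poly of_int e1) t0) (poly (map_poly of_int e2) t0)
       (poly (map_poly of_int e3) t0)"
proof -
  have ev: "eval_fun t0 (to_fract p) = poly p t0" for p
    using eval_fun_Fract[of 1 t0 p] by (simp add: to_fract_def)
  show ?thesis
    unfolding specialize_curve_def curve_of_roots_def int_poly_fun_def
      to_fract_add [symmetric] to_fract_mult [symmetric] to_fract_uminus [symmetric]
      to_fract_0 [symmetric] weierstrass.map ev
    by simp
qed

text \<open>
  On a Weierstrass curve whose coefficients are regular at \<open>t0\<close>, the coordinates \<open>x\<close> and \<open>y\<close> of
  a point have a pole at \<open>t0\<close> simultaneously, with that of \<open>y\<close> of higher order, so that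
  \<open>(x : y : 1)\<close> then reduces to the point at infinity \<open>(0 : 1 : 0)\<close>.
\<close>

fun specialize_point :: "rat \<Rightarrow> ratfun point \<Rightarrow> rat point" where
  "specialize_point t0 Infinity = Infinity"
| "specialize_point t0 (Affine x y) =
    (if regular_at t0 x \<and> regular_at t0 y then Affine (eval_fun t0 x) (eval_fun t0 y)
     else Infinity)"

text \<open>
  Divisibility and square-freeness are taken in \<open>\<int>[t]\<close>: \<open>h\<close> may have either sign, and
  its content has to be square-free as well. The number 0 counts as a square.
\<close>

definition condition_A :: "int poly \<Rightarrow> int poly \<Rightarrow> int poly \<Rightarrow> rat \<Rightarrow> bool" where
  "condition_A e1 e2 e3 t0 \<longleftrightarrow>
     (\<forall>h :: int poly.
        degree h > 0 \<and> squarefree h \<and>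
        (h dvd (e1 - e2) * (e1 - e3) \<or> h dvd (e2 - e1) * (e2 - e3) \<or> h dvd (e3 - e1) * (e3 - e2))
        \<longrightarrow> \<not> (\<exists>r :: rat. poly (map_poly of_int h) t0 = r ^ 2))"

end

theory Submission
  imports Defs
begin

text \<open>
  Let \<open>P\<close> be a point with a pole at \<open>t0\<close>. In lowest terms over \<open>\<int>[t]\<close>, its first coordinate is
  \<open>x = A / D^2\<close> with \<open>D(t0) = 0\<close>. The square-free part of \<open>A - e_i D^2\<close> divides
  \<open>(e_i - e_j) (e_i - e_k)\<close> and has a square value at \<open>t0\<close>, so condition (A) makes
  \<open>x - e_i = (\<alpha>_i / D)^2\<close> a square, and \<open>P\<close> can be halved within the kernel of specialization.
  Under halving \<open>D\<close> is replaced by a divisor of \<open>D\<close>. As soon as \<open>D\<close> no longer changes,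
  \<open>\<alpha>_1 + \<alpha>_2\<close> is coprime to \<open>D\<close> and therefore divides \<open>e_2 - e_1\<close>, which bounds its value
  at \<open>t0\<close>; but each halving doubles this value up to sign. So the kernel is trivial.
\<close>

section \<open>Places and reduction of points\<close>

text \<open>A place in the sense of valuation theory: \<open>reg\<close> is a valuation ring of the
  field and \<open>ev\<close> its residue map. The last two axioms say that an element outside the
  ring has its inverse in the maximal ideal. Values of \<open>ev\<close> at poles are left
  open.\<close>

locale place =
  fixes reg :: "'a::field \<Rightarrow> bool" and ev :: "'a \<Rightarrow> 'b::field"
  assumes reg_1 [simp]: "reg 1" and ev_1 [simp]: "ev 1 = 1"
    and reg_diff [simp]: "reg a \<Longrightarrow> reg b \<Longrightarrow> reg (a - b)"
    and ev_diff [simp]: "reg a \<Longrightarrow> reg b \<Longrightarrow> ev (a - b) = ev a - ev b"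
    and reg_mult [simp]: "reg a \<Longrightarrow> reg b \<Longrightarrow> reg (a * b)"
    and ev_mult [simp]: "reg a \<Longrightarrow> reg b \<Longrightarrow> ev (a * b) = ev a * ev b"
    and reg_inverse_pole: "\<not> reg a \<Longrightarrow> reg (inverse a)"
    and ev_inverse_pole: "\<not> reg a \<Longrightarrow> ev (inverse a) = 0"
begin

lemma reg_0 [simp]: "reg 0" and ev_0 [simp]: "ev 0 = 0"
  using reg_diff [of 1 1] ev_diff [of 1 1] by simp_all

lemma reg_uminus [simp]: "reg a \<Longrightarrow> reg (- a)" and ev_uminus [simp]: "reg a \<Longrightarrow> ev (- a) = - ev a"
  using reg_diff [of 0 a] ev_diff [of 0 a] by simp_all

lemma reg_add [simp]: "reg a \<Longrightarrow> reg b \<Longrightarrow> reg (a + b)"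
  and ev_add [simp]: "reg a \<Longrightarrow> reg b \<Longrightarrow> ev (a + b) = ev a + ev b"
  using reg_diff [of a "- b"] ev_diff [of a "- b"] by simp_all

lemma reg_power [simp]: "reg a \<Longrightarrow> reg (a ^ n)"
  and ev_power [simp]: "reg a \<Longrightarrow> ev (a ^ n) = ev a ^ n"
proof -
  have "reg (a ^ n) \<and> ev (a ^ n) = ev a ^ n" if "reg a"
    using that by (induction n) simp_all
  then show "reg a \<Longrightarrow> reg (a ^ n)" "reg a \<Longrightarrow> ev (a ^ n) = ev a ^ n" by blast+
qed

lemma reg_numeral [simp]: "reg (numeral n)" and ev_numeral [simp]: "ev (numeral n) = numeral n"
proof -
  have "reg (of_nat k) \<and> ev (of_nat k) = of_nat k" for k
    by (induction k) simp_all
  from this [of "numeral n"] show "reg (numeral n)" "ev (numeral n) = numeral n"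
    by simp_all
qed

text \<open>If \<open>inverse a\<close> were a pole, then its inverse \<open>a\<close> would have
  value 0.\<close>

lemma reg_inverse: "reg a \<Longrightarrow> ev a \<noteq> 0 \<Longrightarrow> reg (inverse a)"
  using ev_inverse_pole [of "inverse a"] by auto

lemma ev_inverse: "reg a \<Longrightarrow> ev a \<noteq> 0 \<Longrightarrow> ev (inverse a) = inverse (ev a)"
proof -
  assume a: "reg a" "ev a \<noteq> 0"
  then have "a \<noteq> 0" by auto
  then have "ev a * ev (inverse a) = 1"
    using ev_mult [OF a(1) reg_inverse [OF a]] by simp
  then show ?thesis by (simp add: inverse_unique)
qed

lemma reg_divide [simp]: "reg a \<Longrightarrow> reg b \<Longrightarrow> ev b \<noteq> 0 \<Longrightarrow> reg (a / b)"
  and ev_divide [simp]: "reg a \<Longrightarrow> reg b \<Longrightarrow> ev b \<noteq> 0 \<Longrightarrow> ev (a / b) = ev a / ev b"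
  by (simp_all add: divide_inverse reg_inverse ev_inverse)

text \<open>The inverse of a pole \<open>a\<close> has value 0. If \<open>a ^ n\<close> were
  regular, evaluating \<open>a ^ n * inverse a ^ n = 1\<close> would give 0 = 1.\<close>

lemma reg_power_iff [simp]: "n > 0 \<Longrightarrow> reg (a ^ n) \<longleftrightarrow> reg a"
proof
  assume n: "n > 0" and reg: "reg (a ^ n)"
  show "reg a"
  proof (rule ccontr)
    assume a: "\<not> reg a"
    then have "a \<noteq> 0" by auto
    then have "ev (a ^ n) * ev (inverse a ^ n) = 1"
      by (subst ev_mult [symmetric])
        (use reg reg_inverse_pole [OF a] in \<open>simp_all flip: power_mult_distrib\<close>)
    then show False
      using n reg_inverse_pole [OF a] ev_inverse_pole [OF a] by (simp add: zero_power)
  qed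
qed simp

end

section \<open>The group law on a curve given by its roots\<close>

lemma Affine_in_points_iff:
  fixes c1 c2 c3 x y :: "'a::field"
  shows "Affine x y \<in> points (curve_of_roots c1 c2 c3) \<longleftrightarrow> y ^ 2 = (x - c1) * (x - c2) * (x - c3)"
  by (simp add: points_curve_of_roots)

text \<open>Here \<open>l\<close> is the slope of the chord or tangent. The last relation is the
  chord relation multiplied by \<open>y1 + y2\<close> and divided by \<open>x2 - x1\<close>; it
  survives for the tangent. Both relations are polynomial, so they cover the two cases at once and
  can be evaluated at a place.\<close>

lemma add_points_curve_of_roots:
  fixes e1 e2 e3 :: "'a::field"
  assumes P: "Affine x1 y1 \<in> points (curve_of_roots e1 e2 e3)" "Affine x2 y2 \<in> points (curve_of_roots e1 e2 e3)"
    and ne: "\<not> (x1 = x2 \<and> y1 + y2 = 0)"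
  obtains l where
    "add_points (curve_of_roots e1 e2 e3) (Affine x1 y1) (Affine x2 y2) =
      Affine (l ^ 2 + (e1 + e2 + e3) - x1 - x2) (- y1 - l * (l ^ 2 + (e1 + e2 + e3) - x1 - x2 - x1))"
    "l * (x2 - x1) = y2 - y1"
    "l * (y1 + y2) = x1 ^ 2 + x1 * x2 + x2 ^ 2 - (e1 + e2 + e3) * (x1 + x2) + (e1 * e2 + e1 * e3 + e2 * e3)"
proof -
  have eq: "y1 ^ 2 = (x1 - e1) * (x1 - e2) * (x1 - e3)" "y2 ^ 2 = (x2 - e1) * (x2 - e2) * (x2 - e3)"
    using P by (simp_all add: points_curve_of_roots)
  define l where "l = (if x1 = x2
    then (3 * x1 ^ 2 - 2 * (e1 + e2 + e3) * x1 + (e1 * e2 + e1 * e3 + e2 * e3)) / (2 * y1)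
    else (y2 - y1) / (x2 - x1))"
  have add: "add_points (curve_of_roots e1 e2 e3) (Affine x1 y1) (Affine x2 y2) =
      Affine (l ^ 2 + (e1 + e2 + e3) - x1 - x2) (- y1 - l * (l ^ 2 + (e1 + e2 + e3) - x1 - x2 - x1))"
    using ne unfolding l_def by (auto simp: curve_of_roots_def Let_def algebra_simps)
  show thesis
  proof (cases "x1 = x2")
    case True
    have "(y1 - y2) * (y1 + y2) = y1 ^ 2 - y2 ^ 2" by algebra
    with True have "(y1 - y2) * (y1 + y2) = 0" using eq by simp
    moreover from True ne have "y1 + y2 \<noteq> 0" by blast
    ultimately have y: "y1 = y2" by simp
    have y12: "y1 + y2 = 2 * y1" using y by simp
    then have "2 * y1 \<noteq> 0" using \<open>y1 + y2 \<noteq> 0\<close> by simp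
    then have "l * (y1 + y2) = 3 * x1 ^ 2 - 2 * (e1 + e2 + e3) * x1 + (e1 * e2 + e1 * e3 + e2 * e3)"
      unfolding y12 l_def using True by simp
    also have "\<dots> = x1 ^ 2 + x1 * x2 + x2 ^ 2 - (e1 + e2 + e3) * (x1 + x2) + (e1 * e2 + e1 * e3 + e2 * e3)"
      unfolding True by algebra
    finally have "l * (y1 + y2) = x1 ^ 2 + x1 * x2 + x2 ^ 2 - (e1 + e2 + e3) * (x1 + x2) + (e1 * e2 + e1 * e3 + e2 * e3)" .
    with True y add show ?thesis using that by simp
  next
    case False
    then have l: "l * (x2 - x1) = y2 - y1" by (simp add: l_def)
    have "(x2 - x1) * (l * (y1 + y2)) = (y2 - y1) * (y1 + y2)"
      using l by (metis mult.assoc mult.commute)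
    also have "\<dots> = (x2 - x1) * (x1 ^ 2 + x1 * x2 + x2 ^ 2 - (e1 + e2 + e3) * (x1 + x2) + (e1 * e2 + e1 * e3 + e2 * e3))"
      using eq by algebra
    finally show ?thesis using that l add False by auto
  qed
qed

text \<open>Chord and tangent are treated together: the equation at the third point follows from the
  equation at the first point and the two relations for the slope.\<close>

lemma add_points_closed:
  fixes e1 e2 e3 :: "'a::field"
  assumes P: "P \<in> points (curve_of_roots e1 e2 e3)" "Q \<in> points (curve_of_roots e1 e2 e3)"
  shows "add_points (curve_of_roots e1 e2 e3) P Q \<in> points (curve_of_roots e1 e2 e3)"
proof (cases P)
  case (Affine x1 y1)
  note PA = this
  show ?thesis
  proof (cases Q)
    case (Affine x2 y2)
    show ?thesis
    proof (cases "x1 = x2 \<and> y1 + y2 = 0")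
      case True
      then show ?thesis using PA Affine by (simp add: curve_of_roots_def points_def)
    next
      case False
      obtain l where l: "add_points (curve_of_roots e1 e2 e3) P Q =
        Affine (l ^ 2 + (e1 + e2 + e3) - x1 - x2) (- y1 - l * (l ^ 2 + (e1 + e2 + e3) - x1 - x2 - x1))"
        "l * (x2 - x1) = y2 - y1"
        "l * (y1 + y2) = x1 ^ 2 + x1 * x2 + x2 ^ 2 - (e1 + e2 + e3) * (x1 + x2) + (e1 * e2 + e1 * e3 + e2 * e3)"
        using add_points_curve_of_roots [OF _ _ False] P unfolding PA Affine by metis
      have "y1 ^ 2 = (x1 - e1) * (x1 - e2) * (x1 - e3)"
        using P PA by (simp add: points_curve_of_roots)
      moreover define x3 where "x3 = l ^ 2 + (e1 + e2 + e3) - x1 - x2"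
      ultimately have "(- y1 - l * (x3 - x1)) ^ 2 = (x3 - e1) * (x3 - e2) * (x3 - e3)"
        using l(2,3) by algebra
      then show ?thesis using l(1) by (simp add: points_curve_of_roots x3_def)
    qed
  qed (use P PA in simp)
qed (use P in simp)

text \<open>The two slopes satisfy the same relations, and \<open>x2 - x1\<close> and
  \<open>y1 + y2\<close> do not both vanish, so the slopes agree.\<close>

lemma add_points_commute:
  fixes e1 e2 e3 :: "'a::field"
  assumes P: "P \<in> points (curve_of_roots e1 e2 e3)" "Q \<in> points (curve_of_roots e1 e2 e3)"
  shows "add_points (curve_of_roots e1 e2 e3) P Q = add_points (curve_of_roots e1 e2 e3) Q P"
proof (cases "P = Infinity \<or> Q = Infinity")
  case True
  then show ?thesis by (cases P; cases Q) auto
next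
  case False
  then obtain x1 y1 x2 y2 where PQ: "P = Affine x1 y1" "Q = Affine x2 y2"
    by (meson point.exhaust)
  show ?thesis
  proof (cases "x1 = x2 \<and> y1 + y2 = 0")
    case True
    then show ?thesis by (simp add: PQ curve_of_roots_def add.commute)
  next
    case False
    then have ne': "\<not> (x2 = x1 \<and> y2 + y1 = 0)" by (metis add.commute)
    obtain l where l: "add_points (curve_of_roots e1 e2 e3) P Q =
      Affine (l ^ 2 + (e1 + e2 + e3) - x1 - x2) (- y1 - l * (l ^ 2 + (e1 + e2 + e3) - x1 - x2 - x1))"
      "l * (x2 - x1) = y2 - y1"
      "l * (y1 + y2) = x1 ^ 2 + x1 * x2 + x2 ^ 2 - (e1 + e2 + e3) * (x1 + x2) + (e1 * e2 + e1 * e3 + e2 * e3)"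
      using add_points_curve_of_roots [OF _ _ False] P unfolding PQ by metis
    obtain l' where l': "add_points (curve_of_roots e1 e2 e3) Q P =
      Affine (l' ^ 2 + (e1 + e2 + e3) - x2 - x1) (- y2 - l' * (l' ^ 2 + (e1 + e2 + e3) - x2 - x1 - x2))"
      "l' * (x1 - x2) = y1 - y2"
      "l' * (y2 + y1) = x2 ^ 2 + x2 * x1 + x1 ^ 2 - (e1 + e2 + e3) * (x2 + x1) + (e1 * e2 + e1 * e3 + e2 * e3)"
      using add_points_curve_of_roots [OF _ _ ne'] P unfolding PQ by metis
    have "(l - l') * (x2 - x1) = l * (x2 - x1) + l' * (x1 - x2)" by algebra
    also have "\<dots> = 0" using l(2) l'(2) by simp
    finally have "(l - l') * (x2 - x1) = 0" .
    moreover have "l * (y1 + y2) = l' * (y1 + y2)"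
      using l(3) l'(3) by (simp add: ac_simps)
    ultimately have "l' = l" using False by auto
    moreover have "- y1 - l * (x3 - x1) = - y2 - l * (x3 - x2)" for x3
      using l(2) by (simp add: algebra_simps)
    moreover have "l ^ 2 + (e1 + e2 + e3) - x2 - x1 = l ^ 2 + (e1 + e2 + e3) - x1 - x2" by simp
    ultimately show ?thesis
      unfolding l(1) l'(1) by metis
  qed
qed

section \<open>Good reduction is a homomorphism\<close>

text \<open>The last two assumptions express good reduction: by the discriminant formula, the
  reduced curve is again elliptic.\<close>

locale elliptic_reduction = place reg ev
  for reg :: "'a::field \<Rightarrow> bool" and ev :: "'a \<Rightarrow> 'b::field" +
  fixes e1 e2 e3 :: 'a
  assumes reg_e [simp]: "reg e1" "reg e2" "reg e3"
    and distinct_ev: "ev e1 \<noteq> ev e2" "ev e1 \<noteq> ev e3" "ev e2 \<noteq> ev e3"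
    and two_neq_0: "(2 :: 'b) \<noteq> 0"
begin

abbreviation "W \<equiv> curve_of_roots e1 e2 e3"
abbreviation "W' \<equiv> curve_of_roots (ev e1) (ev e2) (ev e3)"

fun reduce :: "'a point \<Rightarrow> 'b point" where
  "reduce Infinity = Infinity"
| "reduce (Affine x y) = (if reg x \<and> reg y then Affine (ev x) (ev y) else Infinity)"

lemma reg_y:
  assumes "Affine x y \<in> points W" "reg x"
  shows "reg y"
  by (rule reg_power_iff [THEN iffD1, of 2]) (use assms in \<open>simp_all add: Affine_in_points_iff\<close>)

lemma reduce_in_points: "P \<in> points W \<Longrightarrow> reduce P \<in> points W'"
proof (cases P)
  case (Affine x y)
  assume P: "P \<in> points W"
  have "ev y ^ 2 = (ev x - ev e1) * (ev x - ev e2) * (ev x - ev e3)" if "reg x" "reg y"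
    using P that unfolding Affine Affine_in_points_iff by (simp flip: ev_power)
  then show ?thesis using Affine by (auto simp: points_curve_of_roots)
qed (simp add: points_curve_of_roots)

text \<open>This reads off values from identities with cleared denominators, where the denominator
  has value 1.\<close>

lemma reg_quotient:
  assumes "x * d = n" "reg d" "ev d = 1" "reg n"
  shows "reg x" "ev x = ev n"
proof -
  have "x = n / d" using assms by (auto simp: field_simps)
  then show "reg x" "ev x = ev n" using assms by simp_all
qed

text \<open>The sum is rewritten in coordinates that are regular at infinity. All denominators then
  become powers of \<open>1 - x2 * u\<close>, which has value 1.\<close>

lemma add_pole_regular:
  assumes P: "Affine x1 y1 \<in> points W" "\<not> reg x1" and Q: "Affine x2 y2 \<in> points W" "reg x2"
  obtains x3 y3 where "add_points W (Affine x1 y1) (Affine x2 y2) = Affine x3 y3"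
    "reg x3" "reg y3" "ev x3 = ev x2" "ev y3 = ev y2"
proof -
  have regy2: "reg y2" using reg_y Q by blast
  note eq = P(1) [unfolded Affine_in_points_iff] Q(1) [unfolded Affine_in_points_iff]
  have "x1 \<noteq> x2" using P Q by auto
  then have "\<not> (x1 = x2 \<and> y1 + y2 = 0)" by blast
  from add_points_curve_of_roots [OF P(1) Q(1) this] obtain l where l:
    "add_points W (Affine x1 y1) (Affine x2 y2) =
      Affine (l ^ 2 + (e1 + e2 + e3) - x1 - x2) (- y1 - l * (l ^ 2 + (e1 + e2 + e3) - x1 - x2 - x1))"
    "l * (x2 - x1) = y2 - y1" by metis
  \<comment> \<open>\<open>u\<close> and \<open>v\<close> are coordinates near infinity: they
    satisfy \<open>v ^ 2 = u * (1 - e1 * u) * (1 - e2 * u) * (1 - e3 * u)\<close>, and both have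
    value 0.\<close>
  define u where "u = inverse x1"
  define v where "v = y1 * u ^ 2"
  define x3 where "x3 = l ^ 2 + (e1 + e2 + e3) - x1 - x2"
  define y3 where "y3 = - y1 - l * (x3 - x1)"
  have u [simp]: "reg u" "ev u = 0"
    using reg_inverse_pole ev_inverse_pole P by (simp_all add: u_def)
  have "x1 \<noteq> 0" using P reg_0 by metis
  then have ux: "u * x1 = 1" by (simp add: u_def)
  have vv: "v ^ 2 = u * (1 - e1 * u) * (1 - e2 * u) * (1 - e3 * u)"
    using eq(1) ux unfolding v_def by algebra
  then have "reg (v ^ 2)" by simp
  then have [simp]: "reg v" by simp
  have "ev v ^ 2 = 0" using vv by (simp flip: ev_power)
  then have [simp]: "ev v = 0" by simp
  define b where "b = e1 * e2 + e1 * e3 + e2 * e3"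
  have l21: "l * (x1 - x2) = y1 - y2" using l(2) by algebra
  have ux12: "1 - x2 * u = u * (x1 - x2)" "1 + x2 * u = u * (x1 + x2)"
    "x2 + b * u = u * (x1 * x2 + b)"
    and x2u: "x2 * u = u ^ 2 * (x1 * x2)"
    using ux by algebra+
  \<comment> \<open>The cubes of \<open>x1\<close> and \<open>x2\<close> cancel. What remains has
    degree 2 in \<open>x1\<close>, so multiplication by \<open>u ^ 2\<close> removes the
    pole.\<close>
  have x3_num: "x3 * (x1 - x2) ^ 2 = (x1 + x2) * (x1 * x2 + b)
    - 2 * (e1 + e2 + e3) * (x1 * x2) - 2 * (e1 * e2 * e3) - 2 * y1 * y2"
  proof -
    have "x3 * (x1 - x2) ^ 2 = (l * (x1 - x2)) ^ 2 + (e1 + e2 + e3 - x1 - x2) * (x1 - x2) ^ 2"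
      unfolding x3_def by algebra
    also have "\<dots> = y1 ^ 2 + y2 ^ 2 - 2 * y1 * y2 + (e1 + e2 + e3 - x1 - x2) * (x1 - x2) ^ 2"
      unfolding l21 by algebra
    also have "\<dots> = (x1 + x2) * (x1 * x2 + b)
        - 2 * (e1 + e2 + e3) * (x1 * x2) - 2 * (e1 * e2 * e3) - 2 * y1 * y2"
      unfolding eq b_def by algebra
    finally show ?thesis .
  qed
  define N where "N = (1 + x2 * u) * (x2 + b * u)
    - 2 * (e1 + e2 + e3) * (x2 * u) - 2 * (e1 * e2 * e3) * u ^ 2 - 2 * v * y2"
  have x3: "x3 * (1 - x2 * u) ^ 2 = N"
  proof -
    have "x3 * (1 - x2 * u) ^ 2 = u ^ 2 * (x3 * (x1 - x2) ^ 2)"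
      unfolding ux12 by algebra
    also have "\<dots> = N"
      unfolding N_def x3_num ux12 unfolding x2u v_def by algebra
    finally show ?thesis .
  qed
  have 1: "reg x3" "ev x3 = ev x2"
    using reg_quotient [OF x3] Q(2) regy2 by (simp_all add: N_def b_def)
  \<comment> \<open>In \<open>(x3 - x2) * (x1 - x2) ^ 2\<close> the terms with \<open>x1 ^ 2\<close>
    cancel too, which leaves \<open>x1 * g + h - 2 * y1 * y2\<close>. The coefficient
    \<open>g\<close> is the derivative of the cubic at \<open>x2\<close>.\<close>
  define g where "g = 3 * x2 ^ 2 - 2 * (e1 + e2 + e3) * x2 + b"
  define h where "h = b * x2 - 2 * (e1 * e2 * e3) - x2 ^ 3"
  define M where "M = (v - y2 * u ^ 2) * (g + u * h)
     - 2 * y2 * ((1 - e1 * u) * (1 - e2 * u) * (1 - e3 * u) - y2 * v * u)"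
  have M: "l * (x3 - x2) * (1 - x2 * u) ^ 3 = M"
  proof -
    have gh: "g + u * h = u * (x1 * g + h)" using ux by algebra
    have e: "1 - e1 * u = u * (x1 - e1)" "1 - e2 * u = u * (x1 - e2)" "1 - e3 * u = u * (x1 - e3)"
      using ux by algebra+
    have e': "u * (x1 - e1) * (u * (x1 - e2)) * (u * (x1 - e3)) = u ^ 3 * y1 ^ 2"
      unfolding eq by algebra
    have "l * (x3 - x2) * (1 - x2 * u) ^ 3
        = u ^ 3 * (l * (x1 - x2)) * (x3 * (x1 - x2) ^ 2 - x2 * (x1 - x2) ^ 2)"
      unfolding ux12 by algebra
    also have "\<dots> = u ^ 3 * (y1 - y2) * (x1 * g + h - 2 * y1 * y2)"
      unfolding l21 x3_num g_def h_def by algebra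
    also have "\<dots> = M"
      unfolding M_def gh e e' v_def by algebra
    finally show ?thesis .
  qed
  have 2: "reg (l * (x3 - x2))" "ev (l * (x3 - x2)) = - (2 * ev y2)"
    using reg_quotient [OF M] Q(2) regy2 by (simp_all add: M_def g_def h_def b_def)
  \<comment> \<open>The line is now based at the second point: the product
    \<open>l * (x3 - x2)\<close> is regular with value \<open>- (2 * ev y2)\<close>, although
    \<open>l\<close> itself may have a pole.\<close>
  have "y3 = - y2 - l * (x3 - x2)"
    using l(2) unfolding y3_def by algebra
  then have "reg y3" "ev y3 = ev y2"
    using 2 regy2 by simp_all
  then show ?thesis using that 1 l(1) unfolding x3_def y3_def by blast
qed

text \<open>If the reduced points are not opposite, one of \<open>x2 - x1\<close> and
  \<open>y1 + y2\<close> has a nonzero value, so the slope is regular and its value is the slope of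
  the reduced line. If they become opposite only after reduction, the slope must have a pole, and so
  does the sum.\<close>

lemma add_regular_regular:
  assumes P: "Affine x1 y1 \<in> points W" "reg x1" and Q: "Affine x2 y2 \<in> points W" "reg x2"
  shows "reduce (add_points W (Affine x1 y1) (Affine x2 y2)) =
    add_points W' (reduce (Affine x1 y1)) (reduce (Affine x2 y2))"
proof (cases "x1 = x2 \<and> y1 + y2 = 0")
  case True
  then have "ev y1 + ev y2 = 0" using ev_add [of y1 y2] reg_y P Q by force
  moreover have "add_points W (Affine x1 y1) (Affine x2 y2) = Infinity"
    using True by (simp add: curve_of_roots_def)
  ultimately show ?thesis using True P Q reg_y by (simp add: curve_of_roots_def)
next
  case ne: False
  have regy [simp]: "reg y1" "reg y2" and regx [simp]: "reg x1" "reg x2"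
    using reg_y P Q by blast+
  have red: "reduce (Affine x1 y1) = Affine (ev x1) (ev y1)" "reduce (Affine x2 y2) = Affine (ev x2) (ev y2)"
    by simp_all
  have P': "Affine (ev x1) (ev y1) \<in> points W'" "Affine (ev x2) (ev y2) \<in> points W'"
    using reduce_in_points [OF P(1)] reduce_in_points [OF Q(1)] by simp_all
  from add_points_curve_of_roots [OF P(1) Q(1) ne] obtain l where l:
    "add_points W (Affine x1 y1) (Affine x2 y2) =
      Affine (l ^ 2 + (e1 + e2 + e3) - x1 - x2) (- y1 - l * (l ^ 2 + (e1 + e2 + e3) - x1 - x2 - x1))"
    "l * (x2 - x1) = y2 - y1"
    "l * (y1 + y2) = x1 ^ 2 + x1 * x2 + x2 ^ 2 - (e1 + e2 + e3) * (x1 + x2) + (e1 * e2 + e1 * e3 + e2 * e3)"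
    by metis
  have ev_l: "ev l * (ev x2 - ev x1) = ev y2 - ev y1"
    "ev l * (ev y1 + ev y2) = ev x1 ^ 2 + ev x1 * ev x2 + ev x2 ^ 2
      - (ev e1 + ev e2 + ev e3) * (ev x1 + ev x2) + (ev e1 * ev e2 + ev e1 * ev e3 + ev e2 * ev e3)"
    if "reg l"
    using arg_cong [OF l(2), of ev] arg_cong [OF l(3), of ev] that by simp_all
  show ?thesis
  proof (cases "ev x1 = ev x2 \<and> ev y1 + ev y2 = 0")
    case True
    define x3 where "x3 = l ^ 2 + (e1 + e2 + e3) - x1 - x2"
    have "\<not> reg x3"
    proof
      assume "reg x3"
      then have "reg (x3 - (e1 + e2 + e3) + x1 + x2)" by simp
      then have "reg (l ^ 2)" unfolding x3_def by (simp add: algebra_simps)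
      then have "reg l" by simp
      note ev = ev_l [OF this]
      \<comment> \<open>With a regular slope the reduced points would coincide at a point with
        second coordinate 0, and the second relation would make the derivative of the cubic vanish
        there. The reduced cubic would then have a double root.\<close>
      have "2 * ev y2 = 0" using ev(1) True by algebra
      then have y: "ev y2 = 0" "ev y1 = 0" using True two_neq_0 by auto
      have "(ev x2 - ev e1) * (ev x2 - ev e2) * (ev x2 - ev e3) = 0"
        using P'(2) y unfolding Affine_in_points_iff by simp
      then have "ev x2 = ev e1 \<or> ev x2 = ev e2 \<or> ev x2 = ev e3" by auto
      moreover have X: "3 * ev x2 ^ 2 - 2 * (ev e1 + ev e2 + ev e3) * ev x2
          + (ev e1 * ev e2 + ev e1 * ev e3 + ev e2 * ev e3) = 0"
        using ev(2) True y by (simp add: power2_eq_square algebra_simps)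
      have "(ev e1 - ev e2) * (ev e1 - ev e3) = 0" if "ev x2 = ev e1"
        using X unfolding that by algebra
      moreover have "(ev e2 - ev e1) * (ev e2 - ev e3) = 0" if "ev x2 = ev e2"
        using X unfolding that by algebra
      moreover have "(ev e3 - ev e1) * (ev e3 - ev e2) = 0" if "ev x2 = ev e3"
        using X unfolding that by algebra
      ultimately show False using distinct_ev by auto
    qed
    then have "reduce (add_points W (Affine x1 y1) (Affine x2 y2)) = Infinity"
      unfolding l(1) x3_def by simp
    moreover have "add_points W' (Affine (ev x1) (ev y1)) (Affine (ev x2) (ev y2)) = Infinity"
      using True by (simp add: curve_of_roots_def)
    ultimately show ?thesis by simp
  next
    case False
    have "reg l"
    proof (cases "ev x1 = ev x2")
      case True
      then have "ev (y1 + y2) \<noteq> 0" using False by simp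
      moreover from this have "y1 + y2 \<noteq> 0" by (metis ev_0)
      then have "l = (x1 ^ 2 + x1 * x2 + x2 ^ 2 - (e1 + e2 + e3) * (x1 + x2) + (e1 * e2 + e1 * e3 + e2 * e3)) / (y1 + y2)"
        using l(3) by (simp add: eq_divide_eq)
      ultimately show ?thesis by simp
    next
      case False
      then have "ev (x2 - x1) \<noteq> 0" by simp
      moreover from this have "x2 - x1 \<noteq> 0" by (metis ev_0)
      then have "l = (y2 - y1) / (x2 - x1)"
        using l(2) by (simp add: eq_divide_eq)
      ultimately show ?thesis by simp
    qed
    note ev = ev_l [OF this]
    from add_points_curve_of_roots [OF P' False] obtain l' where l':
      "add_points W' (Affine (ev x1) (ev y1)) (Affine (ev x2) (ev y2)) =
        Affine (l' ^ 2 + (ev e1 + ev e2 + ev e3) - ev x1 - ev x2)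
          (- ev y1 - l' * (l' ^ 2 + (ev e1 + ev e2 + ev e3) - ev x1 - ev x2 - ev x1))"
      "l' * (ev x2 - ev x1) = ev y2 - ev y1"
      "l' * (ev y1 + ev y2) = ev x1 ^ 2 + ev x1 * ev x2 + ev x2 ^ 2
        - (ev e1 + ev e2 + ev e3) * (ev x1 + ev x2) + (ev e1 * ev e2 + ev e1 * ev e3 + ev e2 * ev e3)"
      by metis
    have "l' * (ev x2 - ev x1) = ev l * (ev x2 - ev x1)" "l' * (ev y1 + ev y2) = ev l * (ev y1 + ev y2)"
      unfolding ev l'(2,3) by simp_all
    then have "l' = ev l" using False by auto
    then show ?thesis unfolding red l(1) l'(1) using \<open>reg l\<close> by simp
  qed
qed

text \<open>
  If the sum \<open>S\<close> had no pole, then neither would \<open>P = S + (- Q)\<close>, by \<open>add_pole_regular\<close>.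
\<close>

lemma add_pole_pole:
  assumes P: "Affine x1 y1 \<in> points W" "\<not> reg x1" and Q: "Affine x2 y2 \<in> points W" "\<not> reg x2"
  shows "reduce (add_points W (Affine x1 y1) (Affine x2 y2)) = Infinity"
proof (cases "x1 = x2 \<and> y1 + y2 = 0")
  case True
  then show ?thesis by (simp add: curve_of_roots_def)
next
  case False
  from add_points_curve_of_roots [OF P(1) Q(1) False] obtain l where l:
    "add_points W (Affine x1 y1) (Affine x2 y2) =
      Affine (l ^ 2 + (e1 + e2 + e3) - x1 - x2) (- y1 - l * (l ^ 2 + (e1 + e2 + e3) - x1 - x2 - x1))"
    "l * (x2 - x1) = y2 - y1" by metis
  define x3 where "x3 = l ^ 2 + (e1 + e2 + e3) - x1 - x2"
  define y3 where "y3 = - y1 - l * (x3 - x1)"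
  note l = l [folded x3_def, folded y3_def]
  have S: "Affine x3 y3 \<in> points W"
    using add_points_closed [OF P(1) Q(1)] l by simp
  have Q': "Affine x2 (- y2) \<in> points W" using Q(1) by (simp add: Affine_in_points_iff)
  have "\<not> reg x3"
  proof
    assume reg: "reg x3"
    then have "x2 \<noteq> x3" using Q by blast
    then have "\<not> (x2 = x3 \<and> - y2 + y3 = 0)" by blast
    from add_points_curve_of_roots [OF Q' S this] obtain l' where l':
      "add_points W (Affine x2 (- y2)) (Affine x3 y3) =
        Affine (l' ^ 2 + (e1 + e2 + e3) - x2 - x3) (y2 - l' * (l' ^ 2 + (e1 + e2 + e3) - x2 - x3 - x2))"
      "l' * (x3 - x2) = y3 - - y2" by (metis minus_minus)
    \<comment> \<open>The line through the opposite of the second point and the sum is the mirror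
      image of the original line, so it leads back to \<open>x1\<close>.\<close>
    have "(l' + l) * (x3 - x2) = 0" using l'(2) l(2) y3_def by algebra
    then have "l' = - l" using \<open>x2 \<noteq> x3\<close> by (simp add: eq_neg_iff_add_eq_0)
    then have "l' ^ 2 + (e1 + e2 + e3) - x2 - x3 = x1" by (simp add: x3_def)
    then have "reg x1"
      using add_pole_regular [OF Q' Q(2) S reg] l'(1) by (metis point.inject)
    then show False using P(2) by blast
  qed
  then show ?thesis using l(1) by simp
qed

theorem reduce_add:
  assumes P: "P \<in> points W" and Q: "Q \<in> points W"
  shows "reduce (add_points W P Q) = add_points W' (reduce P) (reduce Q)"
proof (cases "P = Infinity \<or> Q = Infinity")
  case True
  have "add_points W R Infinity = R" "add_points W' R' Infinity = R'" for R R'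
    by (cases R; simp) (cases R'; simp)
  with True show ?thesis by auto
next
  case False
  then obtain x1 y1 x2 y2 where PQ: "P = Affine x1 y1" "Q = Affine x2 y2"
    by (meson point.exhaust)
  note P = P [unfolded PQ] and Q = Q [unfolded PQ]
  have Inf: "add_points W' R' Infinity = R'" for R' by (cases R') simp_all
  consider "reg x1" "reg x2" | "\<not> reg x1" "\<not> reg x2" | "\<not> reg x1" "reg x2" | "reg x1" "\<not> reg x2" by blast
  then show ?thesis
  proof cases
    case 1
    then show ?thesis unfolding PQ using add_regular_regular P Q by blast
  next
    case 2
    then show ?thesis unfolding PQ using add_pole_pole P Q by simp
  next
    case 3
    with add_pole_regular [OF P _ Q] show ?thesis unfolding PQ using reg_y [OF Q]
      by (metis add_points.simps(1) reduce.simps(2))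
  next
    case 4
    with add_pole_regular [OF Q _ P] have "reduce (add_points W Q P) = reduce P"
      unfolding PQ using reg_y [OF P] by (metis reduce.simps(2))
    with 4 show ?thesis
      using add_points_commute [OF P Q] Inf unfolding PQ by simp
  qed
qed

end

section \<open>Evaluation of polynomials and rational functions at a rational number\<close>

abbreviation eval_int_poly :: "int poly \<Rightarrow> rat \<Rightarrow> rat" where
  "eval_int_poly p \<equiv> poly (map_poly of_int p)"

lemma of_int_poly_hom:
  fixes p q :: "int poly"
  shows of_int_poly_add: "map_poly of_int (p + q) = (map_poly of_int p + map_poly of_int q :: 'a::{comm_ring_1,ring_char_0} poly)"
    and of_int_poly_diff: "map_poly of_int (p - q) = (map_poly of_int p - map_poly of_int q :: 'a poly)"
    and of_int_poly_mult: "map_poly of_int (p * q) = (map_poly of_int p * map_poly of_int q :: 'a poly)"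
  by (intro poly_eqI; simp add: coeff_map_poly coeff_mult)+

lemma of_int_poly_1: "map_poly of_int (1 :: int poly) = (1 :: 'a::{comm_ring_1,ring_char_0} poly)"
  by (simp add: map_poly_1')

lemma of_int_poly_power: "map_poly of_int ((p :: int poly) ^ n) = (map_poly of_int p ^ n :: 'a::{comm_ring_1,ring_char_0} poly)"
  by (induction n) (simp_all add: of_int_poly_mult of_int_poly_1)

lemma of_int_poly_eq_0_iff: "map_poly of_int (p :: int poly) = (0 :: 'a::{comm_ring_1,ring_char_0} poly) \<longleftrightarrow> p = 0"
  by (simp add: map_poly_eq_0_iff)

lemma eval_int_poly_hom [simp]:
  "eval_int_poly 0 t = 0" "eval_int_poly 1 t = 1"
  "eval_int_poly (p + q) t = eval_int_poly p t + eval_int_poly q t"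
  "eval_int_poly (p - q) t = eval_int_poly p t - eval_int_poly q t"
  "eval_int_poly (p * q) t = eval_int_poly p t * eval_int_poly q t"
  "eval_int_poly (p ^ n) t = eval_int_poly p t ^ n"
  by (simp_all add: of_int_poly_hom of_int_poly_1 of_int_poly_power)

lemma int_poly_fun_hom [simp]:
  "int_poly_fun 0 = 0" "int_poly_fun 1 = 1"
  "int_poly_fun (p + q) = int_poly_fun p + int_poly_fun q"
  "int_poly_fun (p - q) = int_poly_fun p - int_poly_fun q"
  "int_poly_fun (p * q) = int_poly_fun p * int_poly_fun q"
  by (simp_all add: int_poly_fun_def of_int_poly_hom of_int_poly_1)

lemma int_poly_fun_power [simp]: "int_poly_fun (p ^ n) = int_poly_fun p ^ n"
  by (induction n) simp_all

lemma int_poly_fun_eq_iff [simp]: "int_poly_fun p = int_poly_fun q \<longleftrightarrow> p = q"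
proof -
  have "int_poly_fun p = int_poly_fun q \<longleftrightarrow> int_poly_fun (p - q) = 0" by simp
  also have "\<dots> \<longleftrightarrow> p = q"
    unfolding int_poly_fun_def by (simp add: of_int_poly_eq_0_iff)
  finally show ?thesis .
qed

lemma int_poly_fun_eq_0_iff [simp]: "int_poly_fun p = 0 \<longleftrightarrow> p = 0"
  using int_poly_fun_eq_iff [of p 0] by simp

section \<open>Rational functions as reduced quotients in Z[t]\<close>

lemma clear_denominators:
  fixes p :: "rat poly"
  obtains n :: int and P :: "int poly" where "n \<noteq> 0" "smult (of_int n) p = map_poly of_int (P :: int poly)"
proof -
  have "\<exists>n P. n \<noteq> 0 \<and> smult (of_int n) p = map_poly of_int (P :: int poly)" for p :: "rat poly"
  proof (induction p)
    case 0
    show ?case by (intro exI [of _ 1] exI [of _ 0]) simp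
  next
    case (pCons a p)
    then obtain n P where n: "n \<noteq> 0" "smult (of_int n) p = map_poly of_int (P :: int poly)" by blast
    obtain k m where a: "a = of_int k / of_int m" "m > 0"
      using quotient_of_div quotient_of_denom_pos by (metis surj_pair)
    have "smult (of_int (m * n)) (pCons a p) = map_poly of_int (pCons (n * k) (smult m P))"
      using a n(2) by (simp add: map_poly_pCons map_poly_smult flip: smult_smult)
    then show ?case using n a by (metis mult_eq_0_iff less_irrefl)
  qed
  then show thesis using that by blast
qed

text \<open>The quotient is reduced in Z[t], integer contents included, because condition (A) speaks
  of divisors in that ring.\<close>

lemma ratfun_as_int_poly_quotient:
  obtains A B :: "int poly" where "B \<noteq> 0" "coprime A B" "f = int_poly_fun A / int_poly_fun B"
proof -
  obtain p q where f: "f = Fract p q" "q \<noteq> 0" by (cases f)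
  obtain n P where P: "n \<noteq> 0" "smult (of_int n) p = map_poly of_int (P :: int poly)" by (rule clear_denominators)
  obtain m Q where Q: "m \<noteq> 0" "smult (of_int m) q = map_poly of_int (Q :: int poly)" by (rule clear_denominators)
  have "Q \<noteq> 0" using f Q by (metis map_poly_0 of_int_eq_0_iff smult_eq_0_iff)
  have "f = Fract (smult (of_int (n * m)) p) (smult (of_int (n * m)) q)"
    using f P Q by (simp add: eq_fract)
  also have "\<dots> = Fract (map_poly of_int (smult m P)) (map_poly of_int (smult n Q))"
  proof -
    have "smult (of_int (n * m)) p = map_poly of_int (smult m P)"
      using P by (simp add: map_poly_smult mult.commute [of "of_int n"] flip: smult_smult)
    moreover have "smult (of_int (n * m)) q = map_poly of_int (smult n Q)"
      using Q by (simp add: map_poly_smult flip: smult_smult)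
    ultimately show ?thesis by simp
  qed
  also have "\<dots> = int_poly_fun (smult m P) / int_poly_fun (smult n Q)"
    by (simp add: int_poly_fun_def Fract_conv_to_fract)
  finally have *: "f = int_poly_fun (smult m P) / int_poly_fun (smult n Q)" .
  define g where "g = gcd (smult m P) (smult n Q)"
  have nz: "smult n Q \<noteq> 0" using \<open>Q \<noteq> 0\<close> P by simp
  then obtain A B where AB: "smult m P = A * g" "smult n Q = B * g" "coprime A B"
    using gcd_coprime_exists unfolding g_def by (metis gcd_eq_0_iff)
  with nz have "g \<noteq> 0" "B \<noteq> 0" by auto
  with * AB show thesis using that by simp
qed

section \<open>The place of the rational function field at a rational number\<close>

lemma eval_fun_to_fract [simp]: "eval_fun t (to_fract p) = poly p t"
  using eval_fun_Fract [of 1 t p] by (simp add: to_fract_def)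

lemma regular_at_to_fract [simp]: "regular_at t (to_fract p)"
  unfolding regular_at_def to_fract_def by (intro exI [of _ p] exI [of _ 1]) simp

lemma regular_at_int_poly_fun [simp]: "regular_at t (int_poly_fun p)"
  and eval_fun_int_poly_fun [simp]: "eval_fun t (int_poly_fun p) = eval_int_poly p t"
  by (simp_all add: int_poly_fun_def)

text \<open>For \<open>t = p / q\<close> in lowest terms this is the primitive polynomial
  \<open>q * T - p\<close>, the minimal polynomial of \<open>t\<close> over the integers.\<close>

definition linear_poly_at :: "rat \<Rightarrow> int poly" where
  "linear_poly_at t = [:- fst (quotient_of t), snd (quotient_of t):]"

text \<open>The last claim is the factor theorem over the integers, a case of the Gauss lemma: after
  multiplication by a power of \<open>q\<close>, division by \<open>q * T - p\<close> leaves a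
  constant remainder, and \<open>q * T - p\<close> is coprime to that power.\<close>

lemma linear_poly_at:
  "degree (linear_poly_at t) = 1" "eval_int_poly (linear_poly_at t) t = 0" "squarefree (linear_poly_at t)"
  "eval_int_poly f t = 0 \<Longrightarrow> linear_poly_at t dvd f"
proof -
  obtain p q where pq: "quotient_of t = (p, q)" by fastforce
  have q: "q > 0" "coprime p q" "t = of_int p / of_int q"
    using pq quotient_of_denom_pos quotient_of_coprime quotient_of_div by blast+
  let ?l = "linear_poly_at t"
  have l: "?l = [:- p, q:]" by (simp add: linear_poly_at_def pq)
  show "degree ?l = 1" using q l by simp
  show root: "eval_int_poly ?l t = 0" using q l by (simp add: map_poly_pCons)
  \<comment> \<open>Primitivity: it rules out constant square factors and constant common factors
    with \<open>q\<close>.\<close>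
  have unit: "is_unit c" if "[:c:] dvd ?l" for c
  proof -
    have "c dvd p" "c dvd q"
      using that unfolding l const_poly_dvd_iff by (auto dest: spec [of _ 0] spec [of _ 1])
    then show ?thesis using q(2) coprime_common_divisor by blast
  qed
  show "squarefree ?l"
  proof (rule squarefreeI)
    fix x assume x: "x ^ 2 dvd ?l"
    have "?l \<noteq> 0" using q l by simp
    then have "degree (x ^ 2) \<le> 1" using dvd_imp_degree_le [OF x] q l by simp
    moreover have "x \<noteq> 0" using x \<open>?l \<noteq> 0\<close> by auto
    ultimately have "degree x = 0" by (simp add: degree_power_eq)
    then obtain c where c: "x = [:c:]" by (rule degree_eq_zeroE)
    have "x dvd ?l" using x by (metis dvd_mult_left power2_eq_square)
    then show "is_unit x" using unit c by (simp add: is_unit_const_poly_iff)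
  qed
  have cop: "coprime ?l [:q ^ k:]" for k
  proof -
    have "coprime ?l [:q:]"
    proof (rule coprimeI)
      fix d assume d: "d dvd ?l" "d dvd [:q:]"
      then have "degree d = 0" using q by (metis degree_pCons_0 dvd_imp_degree_le le_zero_eq less_irrefl pCons_eq_0_iff)
      then obtain c where "d = [:c:]" by (rule degree_eq_zeroE)
      then show "is_unit d" using d unit by (simp add: is_unit_const_poly_iff)
    qed
    then show ?thesis by (metis coprime_power_right_iff poly_const_pow)
  qed
  have div: "\<exists>k g r. smult (q ^ k) f = ?l * g + [:r:]" for f
  proof (induction f)
    case 0
    show ?case by (intro exI [of _ 0]) simp
  next
    case (pCons a f)
    then obtain k g r where g: "smult (q ^ k) f = ?l * g + [:r:]" by blast
    have "smult (q ^ Suc k) (pCons a f) = smult q (pCons 0 (smult (q ^ k) f)) + [:q ^ Suc k * a:]"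
      by simp
    also have "\<dots> = ?l * (smult q (pCons 0 g) + [:r:]) + [:p * r + q ^ Suc k * a:]"
      unfolding g l by (simp add: algebra_simps smult_diff_right)
    finally show ?case by blast
  qed
  show "?l dvd f" if f: "eval_int_poly f t = 0"
  proof -
    obtain k g r where g: "smult (q ^ k) f = ?l * g + [:r:]" using div by blast
    have "eval_int_poly (smult (q ^ k) f) t = 0" using f by (simp add: map_poly_smult)
    then have "r = 0" unfolding g eval_int_poly_hom root by (simp add: map_poly_pCons)
    then have "?l dvd [:q ^ k:] * f" using g by simp
    then show ?thesis using cop coprime_dvd_mult_right_iff by blast
  qed
qed

text \<open>At a common root \<open>t\<close>, the nonconstant \<open>linear_poly_at t\<close> would
  be a common divisor.\<close>

lemma coprime_eval_int_poly:
  assumes "coprime f g" "eval_int_poly g t = 0"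
  shows "eval_int_poly f t \<noteq> 0"
proof
  assume "eval_int_poly f t = 0"
  then have "is_unit (linear_poly_at t)"
    using assms linear_poly_at(4) coprime_common_divisor by blast
  then show False using linear_poly_at(1) [of t] by (metis is_unit_polyE degree_pCons_0 zero_neq_one)
qed

text \<open>For a fraction in lowest terms, a pole means that the denominator vanishes and hence the
  numerator does not, so the inverse is regular with value 0.\<close>

lemma place_regular_at: "place (regular_at t) (eval_fun t)"
proof
  show "regular_at t 1" "eval_fun t 1 = 1"
    using regular_at_to_fract [of t 1] eval_fun_to_fract [of t 1] by simp_all
next
  fix a b
  assume "regular_at t a" "regular_at t b"
  then obtain p q p' q' where pq: "a = Fract p q" "poly q t \<noteq> 0" "b = Fract p' q'" "poly q' t \<noteq> 0"
    unfolding regular_at_def by blast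
  then have "q \<noteq> 0" "q' \<noteq> 0" by auto
  then have 1: "a - b = Fract (p * q' - p' * q) (q * q')" and 2: "a * b = Fract (p * p') (q * q')"
    and nz: "poly (q * q') t \<noteq> 0"
    using pq by simp_all
  from 1 2 nz show "regular_at t (a - b)" "regular_at t (a * b)"
    unfolding regular_at_def by blast+
  show "eval_fun t (a - b) = eval_fun t a - eval_fun t b"
    unfolding 1 eval_fun_Fract [OF nz] using pq by (simp add: eval_fun_Fract field_simps)
  show "eval_fun t (a * b) = eval_fun t a * eval_fun t b"
    unfolding 2 eval_fun_Fract [OF nz] using pq by (simp add: eval_fun_Fract)
next
  fix a
  assume pole: "\<not> regular_at t a"
  obtain A B where AB: "B \<noteq> 0" "coprime A B" "a = int_poly_fun A / int_poly_fun B"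
    by (rule ratfun_as_int_poly_quotient)
  then have a: "a = Fract (map_poly of_int A) (map_poly of_int B)"
    by (simp add: int_poly_fun_def Fract_conv_to_fract)
  then have B: "eval_int_poly B t = 0" using pole unfolding regular_at_def by blast
  then have A: "eval_int_poly A t \<noteq> 0" using coprime_eval_int_poly AB(2) by blast
  then have inv: "inverse a = Fract (map_poly of_int B) (map_poly of_int A)"
    using a by (auto simp: AB)
  show "regular_at t (inverse a)" using A inv unfolding regular_at_def by blast
  show "eval_fun t (inverse a) = 0" unfolding inv eval_fun_Fract [OF A] using B by simp
qed

text \<open>The value of the cofactor, multiplied by a power of the denominator of \<open>t\<close>,
  is a nonzero integer and hence at least 1 in absolute value. The bound is uniform in
  \<open>g\<close>, which is what stops the descent.\<close>

lemma eval_divisor_bound: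
  assumes "g dvd f" "eval_int_poly f t \<noteq> 0"
  shows "\<bar>eval_int_poly g t\<bar> \<le> of_int (snd (quotient_of t)) ^ degree f * \<bar>eval_int_poly f t\<bar>"
proof -
  obtain p q where pq: "quotient_of t = (p, q)" by fastforce
  have q: "q > 0" "t = of_int p / of_int q"
    using pq quotient_of_denom_pos quotient_of_div by blast+
  have int: "\<exists>n. eval_int_poly h t * of_int q ^ degree h = of_int n" for h
  proof -
    have "of_int q ^ degree h / of_int q ^ i = (of_int q :: rat) ^ (degree h - i)" if "i \<le> degree h" for i
      using that q by (simp add: power_diff)
    then have "eval_int_poly h t * of_int q ^ degree h
        = (\<Sum>i\<le>degree h. of_int (coeff h i * p ^ i * q ^ (degree h - i)))"
      unfolding poly_altdef q(2)
      by (auto simp: sum_distrib_right coeff_map_poly degree_map_poly power_divide intro!: sum.cong)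
        (metis times_divide_eq_right)
    also have "\<dots> = of_int (\<Sum>i\<le>degree h. coeff h i * p ^ i * q ^ (degree h - i))" by simp
    finally show ?thesis by blast
  qed
  obtain h where f: "f = g * h" using assms by blast
  have nz: "eval_int_poly h t \<noteq> 0" "g \<noteq> 0" "h \<noteq> 0" using assms f by auto
  obtain n where n: "eval_int_poly h t * of_int q ^ degree h = of_int n" using int by blast
  have "n \<noteq> 0" using n nz q by auto
  then have "1 \<le> \<bar>of_int n :: rat\<bar>" by linarith
  moreover have "1 \<le> (of_int q :: rat) ^ degree g" using q by (intro one_le_power) simp
  ultimately have "1 * 1 \<le> (of_int q) ^ degree g * \<bar>of_int n :: rat\<bar>"
    by (intro mult_mono) auto
  then have "\<bar>eval_int_poly g t\<bar> * 1 \<le> \<bar>eval_int_poly g t\<bar> * ((of_int q) ^ degree g * \<bar>of_int n :: rat\<bar>)"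
    by (intro mult_left_mono) auto
  also have "\<dots> = of_int q ^ degree f * \<bar>eval_int_poly f t\<bar>"
    using nz q by (simp add: f n [symmetric] degree_mult_eq power_add abs_mult)
  finally show ?thesis using pq by simp
qed

section \<open>Two-descent in \<open>\<int>[t]\<close>\<close>

lemma int_square_of_rat_square:
  fixes c :: int and r :: rat
  assumes "of_int c = r ^ 2"
  obtains k where "c = k ^ 2"
proof -
  obtain p q where pq: "quotient_of r = (p, q)" by fastforce
  have q: "q > 0" "coprime p q" "r = of_int p / of_int q"
    using pq quotient_of_denom_pos quotient_of_coprime quotient_of_div by blast+
  have "of_int c * of_int q ^ 2 = (of_int p :: rat) ^ 2"
    using assms q by (simp add: field_simps)
  then have "(of_int (c * q ^ 2) :: rat) = of_int (p ^ 2)" by simp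
  then have *: "c * q ^ 2 = p ^ 2" by (simp only: of_int_eq_iff)
  then have "q ^ 2 dvd p ^ 2" by (metis dvd_triv_right)
  then have "q dvd p" by simp
  then have "is_unit q" by (intro coprime_common_divisor [OF q(2)]) simp_all
  then have "q = 1" using q(1) by simp
  then have "c = p ^ 2" using * by simp
  then show thesis by (rule that)
qed

text \<open>The only units of Z[t] are 1 and -1.\<close>

lemma int_poly_unit_square:
  fixes u :: "int poly"
  assumes "is_unit u"
  shows "u * u = 1"
proof -
  obtain c where "u = [:c:]" "is_unit c" using assms by (rule is_unit_polyE)
  then show ?thesis by (auto simp: zdvd1_eq abs_if one_pCons split: if_splits)
qed

lemma coprime_diff_multiple:
  fixes A B e :: "'a::factorial_ring_gcd"
  shows "coprime (A - e * B) B \<longleftrightarrow> coprime A B"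
proof -
  have "d dvd A - e * B \<longleftrightarrow> d dvd A" if "d dvd B" for d
    using dvd_diff [of d A "e * B"] dvd_add [of d "A - e * B" "e * B"] that by auto
  then show ?thesis unfolding coprime_def by blast
qed

text \<open>
  Comparing denominators in the equation of the curve gives \<open>F^2 = B^3\<close> up to a unit, where
  \<open>B\<close> and \<open>F\<close> are the reduced denominators of \<open>x\<close> and \<open>y\<close>.
\<close>

lemma point_denominators:
  fixes e1 e2 e3 :: "int poly"
  assumes eq: "y ^ 2 = (x - int_poly_fun e1) * (x - int_poly_fun e2) * (x - int_poly_fun e3)"
  obtains A D C :: "int poly" where "D \<noteq> 0" "coprime A D"
    "x = int_poly_fun A / int_poly_fun D ^ 2" "y = int_poly_fun C / int_poly_fun D ^ 3"
    "C ^ 2 = (A - e1 * D ^ 2) * (A - e2 * D ^ 2) * (A - e3 * D ^ 2)"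
proof -
  obtain A B where x: "B \<noteq> 0" "coprime A B" "x = int_poly_fun A / int_poly_fun B"
    by (rule ratfun_as_int_poly_quotient)
  obtain C F where y: "F \<noteq> 0" "coprime C F" "y = int_poly_fun C / int_poly_fun F"
    by (rule ratfun_as_int_poly_quotient)
  define G where "G = (A - e1 * B) * (A - e2 * B) * (A - e3 * B)"
  have nz: "int_poly_fun B \<noteq> 0" "int_poly_fun F \<noteq> 0" using x(1) y(1) by simp_all
  have B: "int_poly_fun A / int_poly_fun B - e = (int_poly_fun A - e * int_poly_fun B) / int_poly_fun B" for e
    using nz by (simp add: field_simps)
  have "(int_poly_fun C / int_poly_fun F) ^ 2 = int_poly_fun G / int_poly_fun B ^ 3"
    using eq unfolding x(3) y(3) B G_def by (simp add: power3_eq_cube)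
  then have "int_poly_fun C ^ 2 * int_poly_fun B ^ 3 = int_poly_fun F ^ 2 * int_poly_fun G"
    using nz by (simp add: power_divide frac_eq_eq mult.commute)
  then have "int_poly_fun (C ^ 2 * B ^ 3) = int_poly_fun (F ^ 2 * G)" by simp
  then have CB: "C ^ 2 * B ^ 3 = F ^ 2 * G" by (simp only: int_poly_fun_eq_iff)
  have "coprime (B ^ 3) G"
    using x(2) unfolding G_def by (simp add: coprime_commute [of B] coprime_diff_multiple)
  moreover have "B ^ 3 dvd F ^ 2 * G" using CB by (metis dvd_triv_right)
  ultimately have BF: "B ^ 3 dvd F ^ 2" by (simp add: coprime_dvd_mult_left_iff)
  then have "B ^ 2 dvd F ^ 2" by (rule power_le_dvd) simp
  then have "B dvd F" by simp
  \<comment> \<open>\<open>D\<close> is the quotient of the two denominators. Since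
    \<open>F ^ 2\<close> and \<open>B ^ 3\<close> divide each other, so do \<open>D ^ 2\<close> and
    \<open>B\<close>.\<close>
  then obtain D where F: "F = B * D" by blast
  have "coprime (F ^ 2) (C ^ 2)" using y(2) by (simp add: coprime_commute)
  moreover have "F ^ 2 dvd C ^ 2 * B ^ 3" using CB by (metis dvd_triv_left)
  ultimately have FB: "F ^ 2 dvd B ^ 3" by (simp add: coprime_dvd_mult_right_iff)
  have F2: "F ^ 2 = B ^ 2 * D ^ 2" "B ^ 3 = B ^ 2 * B" unfolding F by algebra+
  from BF FB have "B dvd D ^ 2" "D ^ 2 dvd B"
    using x(1) unfolding F2 by simp_all
  then have "normalize B = normalize (D ^ 2)" by (intro associatedI)
  then obtain u where u: "is_unit u" "B = u * D ^ 2" by (rule associatedE1) metis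
  have uu: "u * u = 1" using u int_poly_unit_square by blast
  define U where "U = int_poly_fun u"
  have "U * U = 1" unfolding U_def using uu by (metis int_poly_fun_hom(2,5))
  then have U: "inverse U = U" by (rule inverse_unique)
  show thesis
  \<comment> \<open>The unit in \<open>B = u * D ^ 2\<close> and \<open>F = u * D ^ 3\<close> is its
    own inverse and can be moved to the numerators.\<close>
  proof (rule that [of D "u * A" "u * C"])
    show D: "D \<noteq> 0" using x(1) u by auto
    have "coprime A D" using x(2) unfolding u(2) by simp
    then show "coprime (u * A) D"
      using u(1) by (simp add: is_unit_left_imp_coprime)
    show "x = int_poly_fun (u * A) / int_poly_fun D ^ 2"
      unfolding x(3) u(2) by (simp add: divide_inverse U flip: U_def)
    have FD: "F = u * D ^ 3" unfolding F u(2) by algebra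
    show "y = int_poly_fun (u * C) / int_poly_fun D ^ 3"
      unfolding y(3) FD by (simp add: divide_inverse U flip: U_def)
    have "D ^ 6 * (C ^ 2 * u ^ 3) = D ^ 6 * (u ^ 2 * G)"
      using CB unfolding FD u(2) by algebra
    then have "C ^ 2 * u ^ 3 = u ^ 2 * G" using D by simp
    have uuD: "u * (u * X) = X" for X using uu by (simp flip: mult.assoc)
    have "(u * C) ^ 2 = C ^ 2" unfolding power_mult_distrib using uu by (simp add: power2_eq_square)
    also have "\<dots> = u * (u * (u * (u * C ^ 2)))" by (simp only: uuD)
    also have "\<dots> = u * (C ^ 2 * u ^ 3)" by (simp add: power3_eq_cube ac_simps)
    also have "\<dots> = u * (u ^ 2 * G)" by (simp only: \<open>C ^ 2 * u ^ 3 = u ^ 2 * G\<close>)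
    also have "\<dots> = (u * (A - e1 * B)) * (u * (A - e2 * B)) * (u * (A - e3 * B))"
      unfolding G_def by (simp only: power2_eq_square ac_simps)
    also have "\<dots> = (u * A - e1 * D ^ 2) * (u * A - e2 * D ^ 2) * (u * A - e3 * D ^ 2)"
    proof -
      have "u * (A - e * B) = u * A - e * (u * (u * D ^ 2))" for e
        unfolding u(2) by (simp add: right_diff_distrib mult.left_commute)
      then show ?thesis by (simp only: uuD)
    qed
    finally show "(u * C) ^ 2 = (u * A - e1 * D ^ 2) * (u * A - e2 * D ^ 2) * (u * A - e3 * D ^ 2)" .
  qed
qed

text \<open>All multiplicities in \<open>h\<close> are at most 1, so it suffices to look at which
  primes occur.\<close>

lemma squarefree_dvdI:
  fixes h N :: "'a::factorial_semiring"
  assumes "squarefree h" "N \<noteq> 0" "\<And>p. prime p \<Longrightarrow> p dvd h \<Longrightarrow> p dvd N"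
  shows "h dvd N"
proof (rule multiplicity_le_imp_dvd)
  show h: "h \<noteq> 0" using assms(1) by auto
  fix p :: 'a
  assume p: "prime p"
  show "multiplicity p h \<le> multiplicity p N"
  proof (cases "p dvd h")
    case True
    then have "multiplicity p N > 0"
      using assms p by (simp add: prime_multiplicity_gt_zero_iff)
    moreover have "multiplicity p h \<le> 1"
      using assms(1) h p squarefree_factorial_semiring'' by blast
    ultimately show ?thesis by linarith
  qed (simp add: not_dvd_imp_multiplicity_0)
qed

text \<open>
  A prime that divides the square-free part of \<open>A1\<close> occurs in \<open>A1\<close> to an odd power, so it
  divides \<open>A2\<close> or \<open>A3\<close> too, and hence one of the differences \<open>f2\<close>, \<open>f3\<close>.
\<close>

lemma factor_is_square:
  fixes A1 A2 A3 C D f2 f3 :: "int poly"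
  assumes prod: "C ^ 2 = A1 * A2 * A3" and cop: "coprime A1 D"
    and diff: "A1 - A2 = f2 * D ^ 2" "A1 - A3 = f3 * D ^ 2"
    and f: "f2 \<noteq> 0" "f3 \<noteq> 0"
    and D: "eval_int_poly D t = 0"
    and A: "\<And>h. degree h > 0 \<Longrightarrow> squarefree h \<Longrightarrow> h dvd f2 * f3 \<Longrightarrow> \<not> (\<exists>r. eval_int_poly h t = r ^ 2)"
  obtains \<alpha> where "A1 = \<alpha> ^ 2"
proof -
  \<comment> \<open>As \<open>D\<close> vanishes at \<open>t\<close>, the three factors share the
    value \<open>a\<close> there. Then \<open>a ^ 3\<close> is a square, and so is
    \<open>a\<close>.\<close>
  define a where "a = eval_int_poly A1 t"
  have a: "a \<noteq> 0" using coprime_eval_int_poly [OF cop D] by (simp add: a_def)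
  have a23: "eval_int_poly A2 t = a" "eval_int_poly A3 t = a"
    using arg_cong [OF diff(1), of "\<lambda>p. eval_int_poly p t"]
      arg_cong [OF diff(2), of "\<lambda>p. eval_int_poly p t"] D by (simp_all add: a_def)
  then have nz: "A1 \<noteq> 0" "A2 \<noteq> 0" "A3 \<noteq> 0" using a by (auto simp: a_def)
  have "eval_int_poly C t ^ 2 = a ^ 3"
    using arg_cong [OF prod, of "\<lambda>p. eval_int_poly p t"] a23 by (simp add: a_def power3_eq_cube)
  then have a_square: "a = (eval_int_poly C t / a) ^ 2"
    using a by (simp add: power_divide power2_eq_square power3_eq_cube)
  define h where "h = squarefree_part A1"
  define s where "s = square_part A1"
  have A1: "A1 = h * s ^ 2" unfolding h_def s_def by (rule squarefree_decompose)
  have h: "squarefree h" "h \<noteq> 0" and s: "s \<noteq> 0" using nz by (auto simp: h_def s_def)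
  have "h dvd f2 * f3"
  proof (rule squarefree_dvdI)
    fix p assume p: "prime p" "p dvd h"
    \<comment> \<open>Otherwise \<open>p\<close> would occur to an odd power in
      \<open>C ^ 2\<close>.\<close>
    have "p dvd A2 * A3"
    proof (rule ccontr)
      assume "\<not> p dvd A2 * A3"
      then have "multiplicity p (A2 * A3) = 0" by (rule not_dvd_imp_multiplicity_0)
      moreover have "multiplicity p h = 1"
        using h p by (metis One_nat_def le_antisym squarefree_factorial_semiring'' less_eq_Suc_le prime_multiplicity_gt_zero_iff prime_imp_prime_elem)
      ultimately have "multiplicity p (A1 * (A2 * A3)) = 1 + 2 * multiplicity p s"
        using p nz h s by (simp add: A1 prime_elem_multiplicity_mult_distrib prime_elem_multiplicity_power_distrib)
      moreover have "multiplicity p (C ^ 2) = 2 * multiplicity p C"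
        using p prod nz by (subst prime_elem_multiplicity_power_distrib) auto
      ultimately show False using prod by (metis even_plus_one_iff dvd_triv_left mult.assoc add.commute)
    qed
    then have "p dvd A2 \<or> p dvd A3" using p by (simp add: prime_dvd_mult_iff)
    moreover have pA1: "p dvd A1" using p A1 by simp
    ultimately have "p dvd f2 * D ^ 2 \<or> p dvd f3 * D ^ 2"
      using diff by (metis dvd_diff)
    moreover have "\<not> p dvd D"
      using cop pA1 p by (meson coprime_common_divisor not_prime_unit)
    ultimately show "p dvd f2 * f3"
      using p by (auto simp: prime_dvd_mult_iff prime_dvd_power_iff)
  qed (use f h in auto)
  moreover have "eval_int_poly h t = (eval_int_poly C t / (a * eval_int_poly s t)) ^ 2"
  proof -
    have a': "a = eval_int_poly h t * eval_int_poly s t ^ 2" using A1 by (simp add: a_def)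
    then have "eval_int_poly s t \<noteq> 0" using a by auto
    then have "eval_int_poly h t = a / eval_int_poly s t ^ 2" using a' by simp
    also have "\<dots> = (eval_int_poly C t / a) ^ 2 / eval_int_poly s t ^ 2"
      using a_square by simp
    finally show ?thesis by (simp add: power_divide power_mult_distrib)
  qed
  \<comment> \<open>By (A) the square-free part is constant. This integer is a rational square,
    hence a square of an integer, and can be absorbed into \<open>s ^ 2\<close>.\<close>
  ultimately have "degree h = 0" using A h(1) by blast
  then obtain c where c: "h = [:c:]" by (rule degree_eq_zeroE)
  then have "of_int c = (eval_int_poly C t / (a * eval_int_poly s t)) ^ 2"
    using \<open>eval_int_poly h t = _\<close> by (simp add: map_poly_pCons)
  then obtain k where "c = k ^ 2" by (rule int_square_of_rat_square)
  then have "A1 = ([:k:] * s) ^ 2"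
    using A1 c by (simp add: power2_eq_square)
  then show thesis by (rule that)
qed

section \<open>Infinite descent in the kernel of specialization\<close>

locale condition_A_curve =
  fixes e1 e2 e3 :: "int poly" and t0 :: rat
  assumes distinct: "e1 \<noteq> e2" "e1 \<noteq> e3" "e2 \<noteq> e3"
    and A: "condition_A e1 e2 e3 t0"
begin

lemma nonsquare:
  assumes "degree h > 0" "squarefree h"
    "h dvd (e1 - e2) * (e1 - e3) \<or> h dvd (e2 - e1) * (e2 - e3) \<or> h dvd (e3 - e1) * (e3 - e2)"
  shows "\<not> (\<exists>r. eval_int_poly h t0 = r ^ 2)"
  using A assms unfolding condition_A_def by blast

text \<open>Since 0 counts as a square, (A) contains good reduction: if two roots agreed at
  \<open>t0\<close>, then \<open>linear_poly_at t0\<close> would be a forbidden divisor with value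
  0.\<close>

lemma eval_roots_distinct:
  "eval_int_poly e1 t0 \<noteq> eval_int_poly e2 t0" "eval_int_poly e1 t0 \<noteq> eval_int_poly e3 t0"
  "eval_int_poly e2 t0 \<noteq> eval_int_poly e3 t0"
proof -
  let ?l = "linear_poly_at t0"
  have "\<exists>r :: rat. eval_int_poly ?l t0 = r ^ 2"
    unfolding linear_poly_at(2) by (intro exI [of _ 0]) simp
  then have *: "\<not> (?l dvd (e1 - e2) * (e1 - e3) \<or> ?l dvd (e2 - e1) * (e2 - e3) \<or> ?l dvd (e3 - e1) * (e3 - e2))"
    using nonsquare [of ?l] linear_poly_at(1,3) [of t0] by auto
  have "?l dvd f - g" if "eval_int_poly f t0 = eval_int_poly g t0" for f g
    using that by (intro linear_poly_at(4)) simp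
  with * show "eval_int_poly e1 t0 \<noteq> eval_int_poly e2 t0" "eval_int_poly e1 t0 \<noteq> eval_int_poly e3 t0"
    "eval_int_poly e2 t0 \<noteq> eval_int_poly e3 t0"
    using dvd_mult dvd_mult2 by metis+
qed

sublocale elliptic_reduction "regular_at t0" "eval_fun t0" "int_poly_fun e1" "int_poly_fun e2" "int_poly_fun e3"
  by (intro elliptic_reduction.intro place_regular_at elliptic_reduction_axioms.intro)
    (simp_all add: eval_roots_distinct)

text \<open>
  These are the data of an affine point with \<open>x - e_i = (\<alpha>_i / D)^2\<close> and a pole at \<open>t0\<close>, with the
  signs of the \<open>\<alpha>_i\<close> chosen so that they take the same value at \<open>t0\<close>.
\<close>

definition kernel_point :: "int poly \<Rightarrow> int poly \<Rightarrow> int poly \<Rightarrow> int poly \<Rightarrow> bool" where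
  "kernel_point D \<alpha>1 \<alpha>2 \<alpha>3 \<longleftrightarrow> D \<noteq> 0 \<and> coprime \<alpha>1 D \<and> eval_int_poly D t0 = 0 \<and>
     eval_int_poly \<alpha>2 t0 = eval_int_poly \<alpha>1 t0 \<and> eval_int_poly \<alpha>3 t0 = eval_int_poly \<alpha>1 t0 \<and>
     \<alpha>1 ^ 2 + e1 * D ^ 2 = \<alpha>2 ^ 2 + e2 * D ^ 2 \<and> \<alpha>1 ^ 2 + e1 * D ^ 2 = \<alpha>3 ^ 2 + e3 * D ^ 2"

text \<open>\<open>D\<close> must vanish at \<open>t0\<close>, since otherwise both coordinates
  would be regular. Then (A), applied at each of the three roots, makes the numerators of all
  \<open>x - e_i\<close> squares.\<close>

lemma kernel_pointI:
  assumes point: "y ^ 2 = (x - int_poly_fun e1) * (x - int_poly_fun e2) * (x - int_poly_fun e3)"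
    and pole: "\<not> (regular_at t0 x \<and> regular_at t0 y)"
  obtains D \<alpha>1 \<alpha>2 \<alpha>3 where "kernel_point D \<alpha>1 \<alpha>2 \<alpha>3"
    "x - int_poly_fun e1 = (int_poly_fun \<alpha>1 / int_poly_fun D) ^ 2"
proof -
  obtain A D C where ADC: "D \<noteq> 0" "coprime A D"
    "x = int_poly_fun A / int_poly_fun D ^ 2" "y = int_poly_fun C / int_poly_fun D ^ 3"
    "C ^ 2 = (A - e1 * D ^ 2) * (A - e2 * D ^ 2) * (A - e3 * D ^ 2)"
    using point_denominators [OF point] by blast
  have D: "eval_int_poly D t0 = 0"
  proof (rule ccontr)
    assume "eval_int_poly D t0 \<noteq> 0"
    then have "regular_at t0 x \<and> regular_at t0 y" unfolding ADC(3,4) by simp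
    with pole show False by blast
  qed
  have cop: "coprime (A - e * D ^ 2) D" for e
    using ADC(2) coprime_diff_multiple [of A "e * D" D] by (simp add: power2_eq_square mult.assoc)
  \<comment> \<open>\<open>f\<close> stands for the chosen root and \<open>g\<close>,
    \<open>h\<close> for the other two, so that one argument serves all three.\<close>
  have square: "\<exists>\<alpha>. A - f * D ^ 2 = \<alpha> ^ 2"
    if "C ^ 2 = (A - f * D ^ 2) * (A - g * D ^ 2) * (A - h * D ^ 2)" "f \<noteq> g" "f \<noteq> h"
      and nsq: "\<And>q. degree q > 0 \<Longrightarrow> squarefree q \<Longrightarrow> q dvd (f - g) * (f - h) \<Longrightarrow> \<not> (\<exists>r. eval_int_poly q t0 = r ^ 2)"
    for f g h
  proof -
    have fg: "(g - f) * (h - f) = (f - g) * (f - h)" by algebra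
    have "A - f * D ^ 2 - (A - g * D ^ 2) = (g - f) * D ^ 2" "A - f * D ^ 2 - (A - h * D ^ 2) = (h - f) * D ^ 2"
      by algebra+
    then show ?thesis
      using factor_is_square [OF that(1) cop, of "g - f" "h - f" t0] D that(2,3) nsq unfolding fg
      by (metis right_minus_eq)
  qed
  obtain \<alpha>1 where \<alpha>1: "A - e1 * D ^ 2 = \<alpha>1 ^ 2"
    using square [OF ADC(5)] nonsquare distinct by metis
  obtain \<alpha>2 where \<alpha>2: "A - e2 * D ^ 2 = \<alpha>2 ^ 2"
    using square [of e2 e1 e3] ADC(5) nonsquare distinct by (metis mult.commute)
  obtain \<alpha>3 where \<alpha>3: "A - e3 * D ^ 2 = \<alpha>3 ^ 2"
    using square [of e3 e1 e2] ADC(5) nonsquare distinct by (metis mult.commute mult.left_commute)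
  have "eval_int_poly (A - e * D ^ 2) t0 = eval_int_poly A t0" for e using D by simp
  then have \<alpha>: "eval_int_poly \<alpha>1 t0 ^ 2 = eval_int_poly A t0" "eval_int_poly \<alpha>2 t0 ^ 2 = eval_int_poly A t0"
    "eval_int_poly \<alpha>3 t0 ^ 2 = eval_int_poly A t0"
    using \<alpha>1 \<alpha>2 \<alpha>3 by (metis eval_int_poly_hom(6))+
  \<comment> \<open>The three square roots have values at \<open>t0\<close> with the same square, so
    a change of sign makes them equal.\<close>
  have sign: "\<exists>\<beta>. \<beta> ^ 2 = \<alpha> ^ 2 \<and> eval_int_poly \<beta> t0 = eval_int_poly \<alpha>1 t0"
    if "eval_int_poly \<alpha> t0 ^ 2 = eval_int_poly A t0" for \<alpha>
  proof -
    have "eval_int_poly \<alpha> t0 = eval_int_poly \<alpha>1 t0 \<or> eval_int_poly \<alpha> t0 = - eval_int_poly \<alpha>1 t0"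
      using that \<alpha>(1) by (metis power2_eq_iff)
    moreover have "eval_int_poly (0 - \<alpha>) t0 = - eval_int_poly \<alpha> t0" unfolding eval_int_poly_hom by simp
    ultimately show ?thesis by (metis diff_0 minus_minus power2_minus)
  qed
  obtain \<beta>2 where \<beta>2: "\<beta>2 ^ 2 = \<alpha>2 ^ 2" "eval_int_poly \<beta>2 t0 = eval_int_poly \<alpha>1 t0"
    using sign \<alpha> by blast
  obtain \<beta>3 where \<beta>3: "\<beta>3 ^ 2 = \<alpha>3 ^ 2" "eval_int_poly \<beta>3 t0 = eval_int_poly \<alpha>1 t0"
    using sign \<alpha> by blast
  show thesis
  proof (rule that)
    show "kernel_point D \<alpha>1 \<beta>2 \<beta>3"
      unfolding kernel_point_def using ADC(1) D \<beta>2 \<beta>3 cop [of e1]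
      by (simp flip: \<alpha>1 \<alpha>2 \<alpha>3) (simp add: \<alpha>1)
    show "x - int_poly_fun e1 = (int_poly_fun \<alpha>1 / int_poly_fun D) ^ 2"
      unfolding ADC(3) power_divide int_poly_fun_power [symmetric] \<alpha>1 [symmetric]
      using ADC(1) by (simp add: field_simps)
  qed
qed

text \<open>
  One of the four halves of the point with coordinates \<open>x - e_i = r_i^2\<close> is the point with
  \<open>x' - e_i = (r_i + r_j) * (r_i + r_k)\<close>; with our choice of signs it is again in the kernel.
\<close>

lemma kernel_point_half:
  assumes "kernel_point D \<alpha>1 \<alpha>2 \<alpha>3"
  obtains D' \<beta>1 \<beta>2 \<beta>3 where "kernel_point D' \<beta>1 \<beta>2 \<beta>3" "D' dvd D"
    "\<beta>1 ^ 2 * D ^ 2 = (\<alpha>1 + \<alpha>2) * (\<alpha>1 + \<alpha>3) * D' ^ 2"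
proof -
  note k = assms [unfolded kernel_point_def]
  define w where "w = eval_int_poly \<alpha>1 t0"
  have w: "w \<noteq> 0" using coprime_eval_int_poly k unfolding w_def by blast
  let ?d = "int_poly_fun D"
  have d: "?d \<noteq> 0" using k by simp
  define r1 r2 r3 where "r1 = int_poly_fun \<alpha>1 / ?d" and "r2 = int_poly_fun \<alpha>2 / ?d" and "r3 = int_poly_fun \<alpha>3 / ?d"
  \<comment> \<open>\<open>r1 ^ 2 + e1\<close> is the first coordinate of the given point and equals
    \<open>r_i ^ 2 + e_i\<close> for every \<open>i\<close>, so \<open>x\<close> is symmetric in the
    three roots.\<close>
  define x where "x = r1 ^ 2 + int_poly_fun e1 + r1 * r2 + r1 * r3 + r2 * r3"
  define y where "y = (r1 + r2) * (r1 + r3) * (r2 + r3)"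
  have eq: "(int_poly_fun \<alpha> / ?d) ^ 2 + int_poly_fun e = int_poly_fun (\<alpha> ^ 2 + e * D ^ 2) / ?d ^ 2" for \<alpha> e
    using d by (simp add: field_simps)
  have r: "r1 ^ 2 + int_poly_fun e1 = r2 ^ 2 + int_poly_fun e2" "r1 ^ 2 + int_poly_fun e1 = r3 ^ 2 + int_poly_fun e3"
    unfolding r1_def r2_def r3_def eq using k by metis+
  have "x = r2 ^ 2 + int_poly_fun e2 + r1 * r2 + r1 * r3 + r2 * r3"
    "x = r3 ^ 2 + int_poly_fun e3 + r1 * r2 + r1 * r3 + r2 * r3"
    using r by (simp_all add: x_def)
  with x_def have x: "x - int_poly_fun e1 = (r1 + r2) * (r1 + r3)"
    "x - int_poly_fun e2 = (r1 + r2) * (r2 + r3)" "x - int_poly_fun e3 = (r1 + r3) * (r2 + r3)"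
    by (simp_all add: power2_eq_square algebra_simps)
  have point: "y ^ 2 = (x - int_poly_fun e1) * (x - int_poly_fun e2) * (x - int_poly_fun e3)"
    unfolding x y_def by algebra
  \<comment> \<open>Here the choice of signs enters: \<open>x * D ^ 2\<close> has the value
    \<open>4 * w ^ 2\<close> at \<open>t0\<close>, whereas a regular \<open>x\<close> would give
    0.\<close>
  have "\<not> regular_at t0 x"
  proof
    assume reg: "regular_at t0 x"
    have "x * ?d ^ 2 = int_poly_fun (\<alpha>1 ^ 2 + e1 * D ^ 2 + \<alpha>1 * \<alpha>2 + \<alpha>1 * \<alpha>3 + \<alpha>2 * \<alpha>3)"
      unfolding x_def r1_def r2_def r3_def using d by (simp add: field_simps power2_eq_square)
    then have "eval_fun t0 (x * ?d ^ 2) = eval_int_poly (\<alpha>1 ^ 2 + e1 * D ^ 2 + \<alpha>1 * \<alpha>2 + \<alpha>1 * \<alpha>3 + \<alpha>2 * \<alpha>3) t0"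
      by (simp only: eval_fun_int_poly_fun)
    moreover have "eval_fun t0 (x * ?d ^ 2) = 0"
      using reg k by simp
    ultimately have "4 * w ^ 2 = 0"
      using k unfolding eval_int_poly_hom by (simp add: w_def power2_eq_square)
    then show False using w by simp
  qed
  then obtain D' \<beta>1 \<beta>2 \<beta>3 where \<beta>: "kernel_point D' \<beta>1 \<beta>2 \<beta>3"
    "x - int_poly_fun e1 = (int_poly_fun \<beta>1 / int_poly_fun D') ^ 2"
    using kernel_pointI [OF point] by blast
  have d': "int_poly_fun D' \<noteq> 0" and cop: "coprime \<beta>1 D'" using \<beta>(1) unfolding kernel_point_def by simp_all
  have "(r1 + r2) * (r1 + r3) = int_poly_fun ((\<alpha>1 + \<alpha>2) * (\<alpha>1 + \<alpha>3)) / ?d ^ 2"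
    unfolding r1_def r2_def r3_def by (simp add: power2_eq_square flip: add_divide_distrib)
  then have "int_poly_fun \<beta>1 ^ 2 / int_poly_fun D' ^ 2 = int_poly_fun ((\<alpha>1 + \<alpha>2) * (\<alpha>1 + \<alpha>3)) / ?d ^ 2"
    using \<beta>(2) x(1) by (simp only: power_divide)
  then have "int_poly_fun (\<beta>1 ^ 2 * D ^ 2) = int_poly_fun ((\<alpha>1 + \<alpha>2) * (\<alpha>1 + \<alpha>3) * D' ^ 2)"
    using d d' by (simp add: frac_eq_eq)
  then have *: "\<beta>1 ^ 2 * D ^ 2 = (\<alpha>1 + \<alpha>2) * (\<alpha>1 + \<alpha>3) * D' ^ 2"
    by (simp only: int_poly_fun_eq_iff)
  then have "D' ^ 2 dvd \<beta>1 ^ 2 * D ^ 2" by (metis dvd_triv_right)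
  moreover have "coprime (D' ^ 2) (\<beta>1 ^ 2)" using cop by (simp add: coprime_commute)
  ultimately have "D' dvd D" by (simp add: coprime_dvd_mult_right_iff)
  then show thesis using that \<beta>(1) * by blast
qed

text \<open>
  Halving does not increase \<open>D\<close>, and once \<open>D\<close> has become stationary, \<open>\<alpha>1 + \<alpha>2\<close> is a divisor of
  \<open>e2 - e1\<close> whose value at \<open>t0\<close> doubles in absolute value with every halving.
\<close>

lemma no_kernel_point: "\<not> kernel_point D \<alpha>1 \<alpha>2 \<alpha>3"
proof
  \<comment> \<open>The number of prime factors with multiplicity. Starting from the least level,
    halving can change \<open>D\<close> only by a unit.\<close>
  define level where "level D = size (prime_factorization D)" for D :: "int poly"
  assume "kernel_point D \<alpha>1 \<alpha>2 \<alpha>3"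
  then obtain D0 where D0: "\<exists>\<alpha>1 \<alpha>2 \<alpha>3. kernel_point D0 \<alpha>1 \<alpha>2 \<alpha>3"
    and least: "\<And>D. \<exists>\<alpha>1 \<alpha>2 \<alpha>3. kernel_point D \<alpha>1 \<alpha>2 \<alpha>3 \<Longrightarrow> level D0 \<le> level D"
    using ex_has_least_nat [of "\<lambda>D. \<exists>\<alpha>1 \<alpha>2 \<alpha>3. kernel_point D \<alpha>1 \<alpha>2 \<alpha>3" D level] by blast
  \<comment> \<open>A common bound for the values at \<open>t0\<close> of all divisors of
    \<open>e2 - e1\<close>.\<close>
  define N where "N = of_int (snd (quotient_of t0)) ^ degree (e2 - e1) * \<bar>eval_int_poly (e2 - e1) t0\<bar>"
  have step: "2 * \<bar>eval_int_poly \<alpha>1 t0\<bar> \<le> N \<and> (\<exists>D' \<beta>1 \<beta>2 \<beta>3. kernel_point D' \<beta>1 \<beta>2 \<beta>3 \<and> level D' = level D0 \<and>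
      \<bar>eval_int_poly \<beta>1 t0\<bar> = 2 * \<bar>eval_int_poly \<alpha>1 t0\<bar>)"
    if k: "kernel_point D \<alpha>1 \<alpha>2 \<alpha>3" "level D = level D0" for D \<alpha>1 \<alpha>2 \<alpha>3
  proof -
    obtain D' \<beta>1 \<beta>2 \<beta>3 where \<beta>: "kernel_point D' \<beta>1 \<beta>2 \<beta>3" "D' dvd D"
      "\<beta>1 ^ 2 * D ^ 2 = (\<alpha>1 + \<alpha>2) * (\<alpha>1 + \<alpha>3) * D' ^ 2"
      using kernel_point_half [OF k(1)] by blast
    note k' = k(1) [unfolded kernel_point_def] and \<beta>' = \<beta>(1) [unfolded kernel_point_def]
    obtain u where u: "D = D' * u" using \<beta>(2) by blast
    then have nz: "D' \<noteq> 0" "u \<noteq> 0" using k' by auto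
    then have "level D = level D' + level u"
      unfolding level_def u by (simp add: prime_factorization_mult)
    moreover have "level D0 \<le> level D'" using least \<beta>(1) by blast
    ultimately have lev: "level D' = level D0" "level u = 0" using k(2) by simp_all
    then have "is_unit u"
      using nz unfolding level_def by (simp add: prime_factorization_empty_iff)
    then have "D ^ 2 = D' ^ 2"
      using int_poly_unit_square [of u] unfolding u by (simp add: power2_eq_square ac_simps)
    then have sq: "\<beta>1 ^ 2 = (\<alpha>1 + \<alpha>2) * (\<alpha>1 + \<alpha>3)" using \<beta>(3) nz by simp
    \<comment> \<open>\<open>\<alpha>1 + \<alpha>2\<close> divides \<open>\<beta>1 ^ 2\<close> and
      inherits its coprimality to the denominator.\<close>
    have "coprime (\<beta>1 ^ 2) (D' ^ 2)" using \<beta>' by simp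
    then have "coprime (\<alpha>1 + \<alpha>2) (D' ^ 2)" unfolding sq by (simp add: coprime_mult_left_iff)
    then have cop: "coprime (\<alpha>1 + \<alpha>2) (D ^ 2)" using \<open>D ^ 2 = D' ^ 2\<close> by simp
    have "(\<alpha>1 + \<alpha>2) * (\<alpha>1 - \<alpha>2) = \<alpha>1 ^ 2 - \<alpha>2 ^ 2" by algebra
    also have "\<dots> = (e2 - e1) * D ^ 2" using k' by (simp add: algebra_simps)
    finally have "\<alpha>1 + \<alpha>2 dvd (e2 - e1) * D ^ 2" by (metis dvd_triv_left)
    then have "\<alpha>1 + \<alpha>2 dvd e2 - e1" using cop by (simp add: coprime_dvd_mult_left_iff)
    moreover have "eval_int_poly (e2 - e1) t0 \<noteq> 0"
      using eval_roots_distinct by simp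
    ultimately have "\<bar>eval_int_poly (\<alpha>1 + \<alpha>2) t0\<bar> \<le> N" unfolding N_def by (rule eval_divisor_bound)
    then have "2 * \<bar>eval_int_poly \<alpha>1 t0\<bar> \<le> N" using k' by simp
    \<comment> \<open>The \<open>\<alpha>\<close> have equal values at \<open>t0\<close>, so each
      factor in \<open>sq\<close> has twice that value.\<close>
    moreover have "eval_int_poly \<beta>1 t0 ^ 2 = (2 * eval_int_poly \<alpha>1 t0) ^ 2"
      using arg_cong [OF sq, of "\<lambda>p. eval_int_poly p t0"] k' by (simp add: power2_eq_square)
    then have "\<bar>eval_int_poly \<beta>1 t0\<bar> = 2 * \<bar>eval_int_poly \<alpha>1 t0\<bar>"
      by (metis power2_eq_iff abs_minus abs_mult abs_numeral)
    ultimately show ?thesis using \<beta>(1) lev by blast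
  qed
  obtain \<gamma>1 \<gamma>2 \<gamma>3 where \<gamma>: "kernel_point D0 \<gamma>1 \<gamma>2 \<gamma>3" using D0 by blast
  define w where "w = \<bar>eval_int_poly \<gamma>1 t0\<bar>"
  have "eval_int_poly \<gamma>1 t0 \<noteq> 0"
    using coprime_eval_int_poly \<gamma> unfolding kernel_point_def by blast
  then have w: "w > 0" by (simp add: w_def)
  have chain: "\<exists>D \<alpha>1 \<alpha>2 \<alpha>3. kernel_point D \<alpha>1 \<alpha>2 \<alpha>3 \<and> level D = level D0 \<and> \<bar>eval_int_poly \<alpha>1 t0\<bar> = 2 ^ n * w" for n :: nat
  proof (induction n)
    case 0
    show ?case using \<gamma> w_def by auto
  next
    case (Suc n)
    then obtain D \<alpha>1 \<alpha>2 \<alpha>3 where "kernel_point D \<alpha>1 \<alpha>2 \<alpha>3" "level D = level D0" "\<bar>eval_int_poly \<alpha>1 t0\<bar> = 2 ^ n * w"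
      by blast
    with step [of D \<alpha>1 \<alpha>2 \<alpha>3] show ?case by (metis mult.assoc power_Suc)
  qed
  \<comment> \<open>After this many halvings the value exceeds the bound \<open>N\<close>.\<close>
  obtain n where "N / w < of_nat n" using reals_Archimedean2 by blast
  also have "of_nat n < (2 :: rat) ^ n" by (rule of_nat_less_two_power)
  finally have "N / w < 2 ^ n" .
  then have "N < 2 ^ n * w" using w by (simp add: field_simps)
  moreover obtain D \<alpha>1 \<alpha>2 \<alpha>3 where "kernel_point D \<alpha>1 \<alpha>2 \<alpha>3" "level D = level D0" "\<bar>eval_int_poly \<alpha>1 t0\<bar> = 2 ^ n * w"
    using chain by blast
  then have "2 * (2 ^ n * w) \<le> N" using step by metis
  moreover have "2 ^ n * w > 0" using w by simp
  ultimately show False by linarith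
qed

section \<open>From the trivial kernel to injectivity\<close>

lemma reduce_eq_Infinity:
  assumes "P \<in> points W" "reduce P = Infinity"
  shows "P = Infinity"
proof (cases P)
  case (Affine x y)
  then have "\<not> (regular_at t0 x \<and> regular_at t0 y)" using assms(2) by auto
  moreover have "y ^ 2 = (x - int_poly_fun e1) * (x - int_poly_fun e2) * (x - int_poly_fun e3)"
    using assms(1) Affine by (simp add: Affine_in_points_iff)
  ultimately obtain D \<alpha>1 \<alpha>2 \<alpha>3 where "kernel_point D \<alpha>1 \<alpha>2 \<alpha>3"
    by (metis kernel_pointI)
  then show ?thesis using no_kernel_point by simp
qed

text \<open>For points with the same image, \<open>P - Q\<close> lies in the trivial kernel; and by
  the definition of addition, two affine points have sum \<open>Infinity\<close> only if they are
  opposite.\<close>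

lemma inj_on_reduce: "inj_on reduce (points W)"
proof (rule inj_onI)
  fix P Q
  assume P: "P \<in> points W" and Q: "Q \<in> points W" and eq: "reduce P = reduce Q"
  show "P = Q"
  proof (cases "P = Infinity \<or> Q = Infinity")
    case True
    then show ?thesis using reduce_eq_Infinity P Q eq by (metis reduce.simps(1))
  next
    case False
    then obtain x1 y1 x2 y2 where PQ: "P = Affine x1 y1" "Q = Affine x2 y2"
      by (meson point.exhaust)
    have Q': "Affine x2 (- y2) \<in> points W"
      using Q unfolding PQ by (simp add: Affine_in_points_iff)
    have "reduce P \<noteq> Infinity" "reduce Q \<noteq> Infinity" using False reduce_eq_Infinity P Q by blast+
    then have "add_points W' (reduce P) (reduce (Affine x2 (- y2))) = Infinity"
      unfolding eq unfolding PQ by (auto simp: curve_of_roots_def split: if_splits)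
    then have "reduce (add_points W P (Affine x2 (- y2))) = Infinity"
      using reduce_add [OF P Q'] by simp
    then have "add_points W P (Affine x2 (- y2)) = Infinity"
      by (rule reduce_eq_Infinity [rotated]) (rule add_points_closed [OF P Q'])
    then show ?thesis
      unfolding PQ by (auto simp: curve_of_roots_def Let_def split: if_splits)
  qed
qed

lemma reduce_eq_specialize_point: "reduce = specialize_point t0"
proof
  show "reduce P = specialize_point t0 P" for P by (cases P) simp_all
qed

end

theorem theorem1p1:
  fixes e1 e2 e3 :: "int poly" and E :: "ratfun weierstrass" and t0 :: rat
  assumes E: "E = curve_of_roots (int_poly_fun e1) (int_poly_fun e2) (int_poly_fun e3)"
    and elliptic: "elliptic_curve E"
    and nonconstant: "nonconstant_curve E"
    and A: "condition_A e1 e2 e3 t0"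
  shows "elliptic_curve (specialize_curve t0 E) \<and>
    specialize_point t0 \<in> hom (point_group E) (point_group (specialize_curve t0 E)) \<and>
    inj_on (specialize_point t0) (carrier (point_group E))"
proof -
  have "e1 \<noteq> e2" "e1 \<noteq> e3" "e2 \<noteq> e3"
    using elliptic unfolding E elliptic_curve_def discriminant_curve_of_roots by auto
  then interpret condition_A_curve e1 e2 e3 t0 using A by unfold_locales
  have W': "specialize_curve t0 E = W'"
    unfolding E specialize_curve_of_roots by simp
  have "elliptic_curve W'"
    using distinct_ev unfolding elliptic_curve_def discriminant_curve_of_roots by simp
  moreover have "reduce \<in> hom (point_group W) (point_group W')"
    unfolding hom_def point_group_def using reduce_in_points reduce_add by simp
  moreover have "inj_on reduce (carrier (point_group W))"
    using inj_on_reduce by (simp add: point_group_def)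
  ultimately show ?thesis
    unfolding W' unfolding E reduce_eq_specialize_point by blast
qed

end
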